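(* Let $p:Y\to X$ be a Galois cover of finite graphs with Galois group $\mathrm{Gal}(Y/X)\cong\mathfrak S_3$. Let $Q=Y/\langle(1,2,3)\rangle$ and $T=Y/\langle(1,2)\rangle$ be the intermediate covers corresponding to the cyclic subgroups $C_3=\langle(1,2,3)\rangle$ and $C_2=\langle(1,2)\rangle$ of $\mathfrak S_3$, respectively. Then the Ihara zeta functions satisfy \[ \zeta_Y(u)\,\zeta_X(u)^2=\zeta_Q(u)\,\zeta_T(u)^2 . \]
   Context: Graphs are finite simple graphs. A covering map $p:\tilde X\to X$ is a surjective graph morphism such that for every vertex $\tilde v$ of $\tilde X$, $p$ induces a bijection from the set of edges incident to $\tilde v$ to the set of edges incident to $p(\tilde v)$. A cover $p:\tilde X\to X$ is Galois with Galois group $G=\mathrm{Gal}(\tilde X/X)$ if $G$ acts on $\tilde X$ (by graph automorphisms), acts freely and transitively on each fiber $p^{-1}(w)$, $w\in V(X)$, and $\tilde X/G$ is isomorphic to $X$. For a subgroup $H\le G$, the quotient graph $\tilde X/H$ has the $H$-orbits of vertices as vertices, two orbits being adjacent iff some representatives are adjacent; it is an intermediate cover $\tilde X\to\tilde X/H\to X$. Ihara zeta function: view a graph $\Gamma$ as a bidirected graph, each edge being replaced by two directed edges of opposite directions; $\overline e$ denotes the opposite of the directed edge $e$. A cycle $C=(e_0,\dots,e_{l-1})$ is a closed walk of directed edges (the terminal vertex of $e_i$ is the initial vertex of $e_{i+1}$, indices in $\mathbb Z/l\mathbb Z$) of length $\nu(C)=l\geq 1$. It is non-backtracking if $e_i\ne\overline{e_{i+1}}$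 for every $i\in\mathbb Z/l\mathbb Z$. A non-backtracking cycle is prime if it is not of the form $D^k$ for a cycle $D$ and an integer $k>1$. Two prime cycles are equivalent if one is obtained from the other by a cyclic shift $(e_k,e_{k+1},\dots,e_{k+l-1})$; an equivalence class $[C]$ is called a prime of $\Gamma$. The zeta function is \[ \zeta_\Gamma(u)=\prod_{[C]}\bigl(1-u^{\nu(C)}\bigr)^{-1}, \] the product running over all primes $[C]$ of $\Gamma$ (as a formal power series in $u$, or equivalently a function for $|u|$ small). *)

theory Defs
  imports
    "Graph_Theory.Pair_Digraph"
    "Graph_Theory.Digraph_Isomorphism"
    "HOL-Computational_Algebra.Formal_Power_Series"
    "HOL-Combinatorics.Cycles"
    "HOL-Algebra.Group_Action"
    "HOL-Algebra.Sym_Groups"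
begin

text \<open>
  A finite simple graph is a \<^locale>\<open>pair_graph\<close>: an irreflexive symmetric finite set of arcs
  \<open>(u, v)\<close> over a finite set of vertices. The arcs are thus exactly the directed edges of the
  bidirected graph, and \<^const>\<open>prod.swap\<close> sends a directed edge to its opposite.
\<close>

text \<open>
  In a simple graph, mapping an edge at \<open>v\<close> to its orientation leaving \<open>v\<close> identifies the edges
  incident to \<open>v\<close> with the arcs out of \<open>v\<close>; local bijectivity is stated on the latter.
\<close>

definition covering_map :: "('b \<Rightarrow> 'a) \<Rightarrow> 'b pair_pre_digraph \<Rightarrow> 'a pair_pre_digraph \<Rightarrow> bool" where
  "covering_map p Y X \<longleftrightarrow>
     p ` pverts Y = pverts X \<and>
     (\<forall>(u, v) \<in> parcs Y. (p u, p v) \<in> parcs X) \<and>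
     (\<forall>v \<in> pverts Y. bij_betw (map_prod p p) (out_arcs (with_proj Y) v) (out_arcs (with_proj X) (p v)))"

definition quotient_graph ::
  "('g, 'm) monoid_scheme \<Rightarrow> ('g \<Rightarrow> 'b \<Rightarrow> 'b) \<Rightarrow> 'b pair_pre_digraph \<Rightarrow> 'g set \<Rightarrow> 'b set pair_pre_digraph"
where
  "quotient_graph G \<phi> Y H =
     (let V = orbits (G\<lparr>carrier := H\<rparr>) (pverts Y) \<phi>
      in \<lparr> pverts = V,
           parcs = {(A, B). A \<in> V \<and> B \<in> V \<and> (\<exists>a \<in> A. \<exists>b \<in> B. (a, b) \<in> parcs Y)} \<rparr>)"

definition galois_cover ::
  "('g, 'm) monoid_scheme \<Rightarrow> ('g \<Rightarrow> 'b \<Rightarrow> 'b) \<Rightarrow> ('b \<Rightarrow> 'a)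
     \<Rightarrow> 'b pair_pre_digraph \<Rightarrow> 'a pair_pre_digraph \<Rightarrow> bool"
where
  "galois_cover G \<phi> p Y X \<longleftrightarrow>
     covering_map p Y X \<and>
     group_action G (pverts Y) \<phi> \<and>
     (\<forall>g \<in> carrier G. \<forall>u \<in> pverts Y. \<forall>v \<in> pverts Y.
        (\<phi> g u, \<phi> g v) \<in> parcs Y \<longleftrightarrow> (u, v) \<in> parcs Y) \<and>
     (\<forall>g \<in> carrier G. \<forall>v \<in> pverts Y. p (\<phi> g v) = p v) \<and>
     (\<forall>v \<in> pverts Y. stabilizer G \<phi> v = {\<one>\<^bsub>G\<^esub>}) \<and>
     (\<forall>u \<in> pverts Y. \<forall>v \<in> pverts Y. p u = p v \<longrightarrow> (\<exists>g \<in> carrier G. \<phi> g u = v)) \<and>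
     digraph_iso (with_proj (quotient_graph G \<phi> Y (carrier G))) (with_proj X)"

definition closed_walk :: "'a pair_pre_digraph \<Rightarrow> ('a \<times> 'a) list \<Rightarrow> bool" where
  "closed_walk \<Gamma> C \<longleftrightarrow>
     C \<noteq> [] \<and> set C \<subseteq> parcs \<Gamma> \<and>
     (\<forall>i < length C. snd (C ! i) = fst (C ! (Suc i mod length C)))"

definition non_backtracking :: "('a \<times> 'a) list \<Rightarrow> bool" where
  "non_backtracking C \<longleftrightarrow>
     (\<forall>i < length C. C ! i \<noteq> prod.swap (C ! (Suc i mod length C)))"

definition prime_cycles :: "'a pair_pre_digraph \<Rightarrow> ('a \<times> 'a) list set" where
  "prime_cycles \<Gamma> =
     {C. closed_walk \<Gamma> C \<and> non_backtracking C \<and>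
         \<not> (\<exists>D k. closed_walk \<Gamma> D \<and> k > 1 \<and> C = concat (replicate k D))}"

definition cyclic_equiv :: "'a pair_pre_digraph \<Rightarrow> (('a \<times> 'a) list \<times> ('a \<times> 'a) list) set" where
  "cyclic_equiv \<Gamma> =
     {(C, D). C \<in> prime_cycles \<Gamma> \<and> D \<in> prime_cycles \<Gamma> \<and> (\<exists>k. D = rotate k C)}"

definition graph_primes :: "'a pair_pre_digraph \<Rightarrow> ('a \<times> 'a) list set set" where
  "graph_primes \<Gamma> = prime_cycles \<Gamma> // cyclic_equiv \<Gamma>"

definition prime_length :: "('a \<times> 'a) list set \<Rightarrow> nat" where
  "prime_length P = the_elem (length ` P)"

text \<open>
  The product over all primes is the limit, for the \<open>X\<close>-adic topology on power series, of the
  finite partial products along the net of finite sets of primes. It exists for every finite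
  graph, see \<open>ihara_zeta_tendsto\<close> below.
\<close>

definition ihara_zeta :: "'a pair_pre_digraph \<Rightarrow> complex fps" where
  "ihara_zeta \<Gamma> =
     Lim (finite_subsets_at_top (graph_primes \<Gamma>))
       (\<lambda>S. \<Prod>P\<in>S. inverse (1 - fps_X ^ prime_length P))"

lemma equiv_cyclic_equiv: "equiv (prime_cycles \<Gamma>) (cyclic_equiv \<Gamma>)"
proof (rule equivI)
  show "cyclic_equiv \<Gamma> \<subseteq> prime_cycles \<Gamma> \<times> prime_cycles \<Gamma>"
    by (auto simp: cyclic_equiv_def)
  show "refl_on (prime_cycles \<Gamma>) (cyclic_equiv \<Gamma>)"
    by (auto simp: refl_on_def cyclic_equiv_def intro: exI[of _ 0])
  show "sym (cyclic_equiv \<Gamma>)"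
  proof (rule symI)
    fix C D assume "(C, D) \<in> cyclic_equiv \<Gamma>"
    then obtain k where k: "C \<in> prime_cycles \<Gamma>" "D \<in> prime_cycles \<Gamma>" "D = rotate k C"
      by (auto simp: cyclic_equiv_def)
    have "C \<noteq> []" using k(1) by (auto simp: prime_cycles_def closed_walk_def)
    have "k mod length C \<le> length C"
      using \<open>C \<noteq> []\<close> by (simp add: less_imp_le)
    then have "(length C - k mod length C + k mod length C) mod length C = 0"
      by simp
    then have "(length C - k mod length C + k) mod length C = 0"
      by (simp only: mod_add_right_eq)
    then have "C = rotate (length C - k mod length C) D"
      by (simp add: k(3) rotate_rotate rotate_id)
    then show "(D, C) \<in> cyclic_equiv \<Gamma>"
      using k(1,2) unfolding cyclic_equiv_def by blast
  qed
  show "trans (cyclic_equiv \<Gamma>)"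
    by (rule transI) (auto simp: cyclic_equiv_def rotate_rotate)
qed

lemma prime_length_eq:
  assumes "P \<in> graph_primes \<Gamma>" "C \<in> P"
  shows "prime_length P = length C"
proof -
  from assms(1) obtain B where B: "P = cyclic_equiv \<Gamma> `` {B}"
    by (auto simp: graph_primes_def quotient_def)
  have "length D = length B" if "D \<in> P" for D
    using that by (auto simp: B cyclic_equiv_def)
  then have "length ` P = {length C}"
    using assms(2) by auto
  then show ?thesis by (simp add: prime_length_def)
qed

lemma graph_primes_memD:
  assumes "P \<in> graph_primes \<Gamma>"
  shows "P \<noteq> {}" "P \<subseteq> prime_cycles \<Gamma>"
  using in_quotient_imp_non_empty[OF equiv_cyclic_equiv] in_quotient_imp_subset[OF equiv_cyclic_equiv]
    assms unfolding graph_primes_def by blast+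

lemma prime_length_pos:
  assumes "P \<in> graph_primes \<Gamma>"
  shows "prime_length P > 0"
proof -
  from graph_primes_memD[OF assms] obtain C where "C \<in> P" "C \<in> prime_cycles \<Gamma>" by blast
  with prime_length_eq[OF assms] show ?thesis
    by (auto simp: prime_cycles_def closed_walk_def)
qed

lemma finite_graph_primes_le:
  assumes "finite (parcs \<Gamma>)"
  shows "finite {P \<in> graph_primes \<Gamma>. prime_length P \<le> n}"
proof (rule finite_subset)
  show "{P \<in> graph_primes \<Gamma>. prime_length P \<le> n}
          \<subseteq> Pow {C. set C \<subseteq> parcs \<Gamma> \<and> length C \<le> n}"
  proof (intro subsetI PowI, clarify)
    fix P C assume P: "P \<in> graph_primes \<Gamma>" "prime_length P \<le> n" and C: "C \<in> P"
    have "C \<in> prime_cycles \<Gamma>" using graph_primes_memD(2)[OF P(1)] C by (rule subsetD)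
    moreover have "length C \<le> n" using prime_length_eq[OF P(1) C] P(2) by simp
    ultimately show "set C \<subseteq> parcs \<Gamma> \<and> length C \<le> n"
      by (simp add: prime_cycles_def closed_walk_def)
  qed
  show "finite (Pow {C. set C \<subseteq> parcs \<Gamma> \<and> length C \<le> n})"
    using finite_lists_length_le[OF assms] by simp
qed

context includes fps_syntax
begin

lemma fps_mult_nth_of_trivial:
  fixes f g :: "'r :: comm_ring_1 fps"
  assumes "\<And>j. j \<le> n \<Longrightarrow> f $ j = 1 $ j" "i \<le> n"
  shows "(f * g) $ i = g $ i"
proof -
  have "(f * g) $ i = (\<Sum>j=0..i. 1 $ j * g $ (i - j))"
    unfolding fps_mult_nth by (rule sum.cong) (use assms in auto)
  also have "\<dots> = (1 * g) $ i" by (simp only: fps_mult_nth)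
  finally show ?thesis by simp
qed

theorem ihara_zeta_tendsto:
  assumes "finite (parcs \<Gamma>)"
  shows "((\<lambda>S. \<Prod>P\<in>S. inverse (1 - fps_X ^ prime_length P)) \<longlongrightarrow> ihara_zeta \<Gamma>)
           (finite_subsets_at_top (graph_primes \<Gamma>))"
proof -
  let ?F = "finite_subsets_at_top (graph_primes \<Gamma>)"
  define z :: "('a \<times> 'a) list set \<Rightarrow> complex fps"
    where "z P = inverse (1 - fps_X ^ prime_length P)" for P
  define S0 where "S0 n = {P \<in> graph_primes \<Gamma>. prime_length P \<le> n}" for n
  have fin: "finite (S0 n)" for n
    unfolding S0_def by (rule finite_graph_primes_le[OF assms])
  have z_triv: "z P $ i = 1 $ i" if "P \<in> graph_primes \<Gamma>" "P \<notin> S0 n" "i \<le> n" for P i n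
  proof -
    have len: "prime_length P > n" using that by (auto simp: S0_def)
    have "(1 - fps_X ^ prime_length P :: complex fps) $ j = 1 $ j" if "j \<le> n" for j
      using that len by (cases "j = 0") auto
    then have "((1 - fps_X ^ prime_length P) * z P) $ i = z P $ i"
      using that(3) by (rule fps_mult_nth_of_trivial)
    moreover have "(1 - fps_X ^ prime_length P) * z P = 1"
      unfolding z_def using len by (intro inverse_mult_eq_1') simp
    ultimately show ?thesis by simp
  qed
  have prod_triv: "(\<Prod>P\<in>S. z P) $ i = 1 $ i"
    if "finite S" "S \<subseteq> graph_primes \<Gamma> - S0 n" "i \<le> n" for S i n
    using that
  proof (induction S arbitrary: i rule: finite_induct)
    case (insert P S)
    from insert.prems have P: "P \<in> graph_primes \<Gamma>" "P \<notin> S0 n" by auto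
    have "(z P * (\<Prod>P\<in>S. z P)) $ i = (\<Prod>P\<in>S. z P) $ i"
      using z_triv[OF P] insert.prems(2) by (rule fps_mult_nth_of_trivial)
    also have "\<dots> = 1 $ i"
      using insert.prems by (intro insert.IH) auto
    finally show ?case
      by (simp only: prod.insert[OF insert.hyps])
  qed simp
  have "((\<lambda>S. \<Prod>P\<in>S. z P) \<longlongrightarrow> Abs_fps (\<lambda>n. (\<Prod>P\<in>S0 n. z P) $ n)) ?F"
  proof (rule tendsto_fpsI)
    fix n
    have "(\<Prod>P\<in>S. z P) $ n = (\<Prod>P\<in>S0 n. z P) $ n"
      if S: "finite S" "S0 n \<subseteq> S" "S \<subseteq> graph_primes \<Gamma>" for S
    proof -
      have "(\<Prod>P\<in>S. z P) = (\<Prod>P\<in>S - S0 n. z P) * (\<Prod>P\<in>S0 n. z P)"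
        using S by (intro prod.subset_diff)
      also have "\<dots> $ n = (\<Prod>P\<in>S0 n. z P) $ n"
      proof (rule fps_mult_nth_of_trivial[OF _ order_refl])
        show "(\<Prod>P\<in>S - S0 n. z P) $ j = 1 $ j" if "j \<le> n" for j
          using S that by (intro prod_triv[of _ n]) auto
      qed
      finally show ?thesis .
    qed
    moreover have "S0 n \<subseteq> graph_primes \<Gamma>" by (auto simp: S0_def)
    ultimately show "\<forall>\<^sub>F S in ?F.
        (\<Prod>P\<in>S. z P) $ n = Abs_fps (\<lambda>n. (\<Prod>P\<in>S0 n. z P) $ n) $ n"
      unfolding eventually_finite_subsets_at_top fps_nth_Abs_fps
      using fin[of n] by blast
  qed
  then have lim: "((\<lambda>S. \<Prod>P\<in>S. inverse (1 - fps_X ^ prime_length P))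
      \<longlongrightarrow> Abs_fps (\<lambda>n. (\<Prod>P\<in>S0 n. z P) $ n)) ?F"
    unfolding z_def .
  have "ihara_zeta \<Gamma> = Abs_fps (\<lambda>n. (\<Prod>P\<in>S0 n. z P) $ n)"
    unfolding ihara_zeta_def by (rule tendsto_Lim[OF finite_subsets_at_top_neq_bot lim])
  with lim show ?thesis by (simp only:)
qed

end

end

theory Submission
  imports Defs
begin

text \<open>
  Let \<open>N\<^sub>m(\<Gamma>)\<close> be the number of non-backtracking closed walks of length \<open>m\<close>. Every such walk is a unique
  power of a prime cycle, so \<open>N\<^sub>m = (\<Sum>d dvd m. d \<pi>\<^sub>d)\<close> where \<open>\<pi>\<^sub>d\<close> is the number of primes of length
  \<open>d\<close>. Hence a linear relation between the \<open>N\<^sub>m\<close> of several graphs passes to the \<open>\<pi>\<^sub>d\<close>, by induction on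
  \<open>d\<close>, and then becomes a multiplicative relation between the zeta functions.

  For \<open>g \<in> G\<close> let \<open>M\<^sub>m(g)\<close> count the non-backtracking walks in \<open>Y\<close> that close up after applying \<open>g\<close>.
  Unique lifting of walks gives \<open>|H| N\<^sub>m(Y/H) = (\<Sum>h\<in>H. M\<^sub>m(h))\<close> for every subgroup \<open>H\<close>. As \<open>M\<^sub>m\<close> is a
  class function, evaluating these sums over the conjugacy classes of \<open>S\<^sub>3\<close> yields
  \<open>N\<^sub>m(Y) + 2 N\<^sub>m(X) = N\<^sub>m(Q) + 2 N\<^sub>m(T)\<close>.
\<close>

subsection \<open>The symmetric group on three letters\<close>

text \<open>The two adjacent transpositions. \<open>\<sigma> \<circ> \<tau>\<close> is the 3-cycle
  (1 2 3), \<open>\<tau> \<circ> \<sigma>\<close> is its inverse, and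
  \<open>\<sigma> \<circ> \<tau> \<circ> \<sigma>\<close> is (1 3).\<close>

definition \<sigma> :: "nat \<Rightarrow> nat" where "\<sigma> = transpose 1 2"
definition \<tau> :: "nat \<Rightarrow> nat" where "\<tau> = transpose 2 3"

text \<open>The multiplication table as rewrite rules towards six normal forms; products of
  non-identity elements that already are normal forms are left out.\<close>

lemma S3_mult:
  "\<sigma> \<circ> \<sigma> = id" "\<sigma> \<circ> (\<sigma> \<circ> \<tau> \<circ> \<sigma>) = \<tau> \<circ> \<sigma>" "\<sigma> \<circ> (\<sigma> \<circ> \<tau>) = \<tau>"
  "\<sigma> \<circ> (\<tau> \<circ> \<sigma>) = \<sigma> \<circ> \<tau> \<circ> \<sigma>"
  "\<tau> \<circ> \<tau> = id" "\<tau> \<circ> (\<sigma> \<circ> \<tau> \<circ> \<sigma>) = \<sigma> \<circ> \<tau>" "\<tau> \<circ> (\<sigma> \<circ> \<tau>) = \<sigma> \<circ> \<tau> \<circ> \<sigma>"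
  "\<tau> \<circ> (\<tau> \<circ> \<sigma>) = \<sigma>"
  "\<sigma> \<circ> \<tau> \<circ> \<sigma> \<circ> \<sigma> = \<sigma> \<circ> \<tau>" "\<sigma> \<circ> \<tau> \<circ> \<sigma> \<circ> \<tau> = \<tau> \<circ> \<sigma>" "\<sigma> \<circ> \<tau> \<circ> \<sigma> \<circ> (\<sigma> \<circ> \<tau> \<circ> \<sigma>) = id"
  "\<sigma> \<circ> \<tau> \<circ> \<sigma> \<circ> (\<sigma> \<circ> \<tau>) = \<sigma>" "\<sigma> \<circ> \<tau> \<circ> \<sigma> \<circ> (\<tau> \<circ> \<sigma>) = \<tau>"
  "\<sigma> \<circ> \<tau> \<circ> \<tau> = \<sigma>" "\<sigma> \<circ> \<tau> \<circ> (\<sigma> \<circ> \<tau> \<circ> \<sigma>) = \<tau>" "\<sigma> \<circ> \<tau> \<circ> (\<sigma> \<circ> \<tau>) = \<tau> \<circ> \<sigma>"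
  "\<sigma> \<circ> \<tau> \<circ> (\<tau> \<circ> \<sigma>) = id"
  "\<tau> \<circ> \<sigma> \<circ> \<sigma> = \<tau>" "\<tau> \<circ> \<sigma> \<circ> \<tau> = \<sigma> \<circ> \<tau> \<circ> \<sigma>" "\<tau> \<circ> \<sigma> \<circ> (\<sigma> \<circ> \<tau> \<circ> \<sigma>) = \<sigma>"
  "\<tau> \<circ> \<sigma> \<circ> (\<sigma> \<circ> \<tau>) = id" "\<tau> \<circ> \<sigma> \<circ> (\<tau> \<circ> \<sigma>) = \<sigma> \<circ> \<tau>"
  by (auto simp: \<sigma>_def \<tau>_def fun_eq_iff transpose_def)

lemma S3_distinct:
  "distinct [id, \<sigma>, \<tau>, \<sigma> \<circ> \<tau> \<circ> \<sigma>, \<sigma> \<circ> \<tau>, \<tau> \<circ> \<sigma>]"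
proof -
  \<comment> \<open>A permutation of \<open>{1..3}\<close> is determined by its values at 1 and 2,
    so pairs of numbers separate the six functions.\<close>
  have "distinct (map (\<lambda>f. (f 1, f 2)) [id, \<sigma>, \<tau>, \<sigma> \<circ> \<tau> \<circ> \<sigma>, \<sigma> \<circ> \<tau>, \<tau> \<circ> \<sigma>])"
    by (simp add: \<sigma>_def \<tau>_def transpose_def)
  then show ?thesis by (subst (asm) distinct_map) simp
qed

text \<open>Six distinct permutations exhaust a group of order 3! = 6.\<close>

lemma carrier_sym_group_3: "carrier (sym_group 3) = {id, \<sigma>, \<tau>, \<sigma> \<circ> \<tau> \<circ> \<sigma>, \<sigma> \<circ> \<tau>, \<tau> \<circ> \<sigma>}"
proof -
  have perm: "\<sigma> permutes {1..3}" "\<tau> permutes {1..3}"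
    by (auto simp: \<sigma>_def \<tau>_def permutes_swap_id)
  have "card {id, \<sigma>, \<tau>, \<sigma> \<circ> \<tau> \<circ> \<sigma>, \<sigma> \<circ> \<tau>, \<tau> \<circ> \<sigma>} = 6"
    using distinct_card[OF S3_distinct] by simp
  moreover have "card {p. p permutes {1..3::nat}} = 6"
    by (subst card_permutations[where n = 3]) (auto simp: fact_numeral)
  ultimately have "{id, \<sigma>, \<tau>, \<sigma> \<circ> \<tau> \<circ> \<sigma>, \<sigma> \<circ> \<tau>, \<tau> \<circ> \<sigma>} = {p. p permutes {1..3}}"
    using perm by (intro card_subset_eq finite_permutations) (auto intro: permutes_compose permutes_id)
  then show ?thesis by (simp add: sym_group_def)
qed

lemma cycle_of_list_S3: "cycle_of_list [1, 2] = \<sigma>" "cycle_of_list [1, 2, 3] = \<sigma> \<circ> \<tau>"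
  by (simp_all add: \<sigma>_def \<tau>_def)

lemma generate_transposition: "generate (sym_group 3) {cycle_of_list [1, 2]} = {id, \<sigma>}"
proof -
  have in_S: "\<sigma> \<in> carrier (sym_group 3)" by (simp add: carrier_sym_group_3)
  have "subgroup {id, \<sigma>} (sym_group 3)"
  proof (rule group.subgroupI[OF sym_group_is_group])
    have "inv\<^bsub>sym_group 3\<^esub> \<sigma> = \<sigma>"
      using in_S by (intro group.inv_equality[OF sym_group_is_group])
        (simp_all add: sym_group_mult sym_group_one S3_mult)
    then show "inv\<^bsub>sym_group 3\<^esub> a \<in> {id, \<sigma>}" if "a \<in> {id, \<sigma>}" for a
      using that monoid.inv_one[OF group.is_monoid[OF sym_group_is_group]] by (auto simp: sym_group_one)
  qed (auto simp: carrier_sym_group_3 sym_group_mult S3_mult)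
  then have "generate (sym_group 3) {\<sigma>} \<subseteq> {id, \<sigma>}"
    by (intro group.generate_subgroup_incl[OF sym_group_is_group]) auto
  moreover have "{id, \<sigma>} \<subseteq> generate (sym_group 3) {\<sigma>}"
    using generate.one[of "sym_group 3"] by (auto simp: sym_group_one intro: generate.incl)
  ultimately show ?thesis unfolding cycle_of_list_S3 by auto
qed

lemma generate_3_cycle: "generate (sym_group 3) {cycle_of_list [1, 2, 3]} = {id, \<sigma> \<circ> \<tau>, \<tau> \<circ> \<sigma>}"
proof -
  have in_S: "\<sigma> \<circ> \<tau> \<in> carrier (sym_group 3)" "\<tau> \<circ> \<sigma> \<in> carrier (sym_group 3)"
    by (simp_all add: carrier_sym_group_3)
  have "subgroup {id, \<sigma> \<circ> \<tau>, \<tau> \<circ> \<sigma>} (sym_group 3)"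
  proof (rule group.subgroupI[OF sym_group_is_group])
    have "inv\<^bsub>sym_group 3\<^esub> (\<sigma> \<circ> \<tau>) = \<tau> \<circ> \<sigma>" "inv\<^bsub>sym_group 3\<^esub> (\<tau> \<circ> \<sigma>) = \<sigma> \<circ> \<tau>"
      by (rule group.inv_equality[OF sym_group_is_group]; use in_S in \<open>simp add: sym_group_mult sym_group_one S3_mult\<close>)+
    then show "inv\<^bsub>sym_group 3\<^esub> a \<in> {id, \<sigma> \<circ> \<tau>, \<tau> \<circ> \<sigma>}" if "a \<in> {id, \<sigma> \<circ> \<tau>, \<tau> \<circ> \<sigma>}" for a
      using that monoid.inv_one[OF group.is_monoid[OF sym_group_is_group]] by (auto simp: sym_group_one)
  qed (auto simp: carrier_sym_group_3 sym_group_mult S3_mult)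
  then have "generate (sym_group 3) {\<sigma> \<circ> \<tau>} \<subseteq> {id, \<sigma> \<circ> \<tau>, \<tau> \<circ> \<sigma>}"
    by (intro group.generate_subgroup_incl[OF sym_group_is_group]) auto
  \<comment> \<open>The inverse of the 3-cycle is obtained as its square.\<close>
  moreover have "\<tau> \<circ> \<sigma> \<in> generate (sym_group 3) {\<sigma> \<circ> \<tau>}"
    using generate.eng[OF generate.incl generate.incl, of "\<sigma> \<circ> \<tau>" "{\<sigma> \<circ> \<tau>}" "\<sigma> \<circ> \<tau>" "sym_group 3"]
    by (simp add: sym_group_mult S3_mult)
  moreover have "{id, \<sigma> \<circ> \<tau>} \<subseteq> generate (sym_group 3) {\<sigma> \<circ> \<tau>}"
    using generate.one[of "sym_group 3"] by (auto simp: sym_group_one intro: generate.incl)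
  ultimately show ?thesis unfolding cycle_of_list_S3 by auto
qed

lemma card_S3:
  "card (carrier (sym_group 3)) = 6" "card {id, \<sigma> \<circ> \<tau>, \<tau> \<circ> \<sigma>} = 3" "card {id, \<sigma>} = 2"
  using distinct_card[OF S3_distinct] S3_distinct by (auto simp: carrier_sym_group_3)

text \<open>The hypothesis makes \<open>K\<close> constant on the conjugacy classes of sizes 1, 3
  and 2: identity, transpositions, 3-cycles.\<close>

lemma S3_class_function_sums:
  fixes K :: "(nat \<Rightarrow> nat) \<Rightarrow> nat"
  assumes K: "\<And>\<pi> \<rho>. \<pi> \<in> carrier (sym_group 3) \<Longrightarrow> \<rho> \<in> carrier (sym_group 3) \<Longrightarrow> K (\<pi> \<circ> \<rho>) = K (\<rho> \<circ> \<pi>)"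
  shows "sum K (carrier (sym_group 3)) = K id + 3 * K \<sigma> + 2 * K (\<sigma> \<circ> \<tau>)"
    and "sum K {id, \<sigma> \<circ> \<tau>, \<tau> \<circ> \<sigma>} = K id + 2 * K (\<sigma> \<circ> \<tau>)"
    and "sum K {id, \<sigma>} = K id + K \<sigma>"
proof -
  \<comment> \<open>By the braid relation both left sides are the value of \<open>K\<close> at (1
    3). Moving the last factor to the front turns one into \<open>K \<tau>\<close> and the other
    into \<open>K \<sigma>\<close>.\<close>
  have "K (\<sigma> \<circ> \<tau> \<circ> \<sigma>) = K (\<sigma> \<circ> (\<sigma> \<circ> \<tau>))" "K (\<tau> \<circ> \<sigma> \<circ> \<tau>) = K (\<tau> \<circ> (\<tau> \<circ> \<sigma>))"
    by (rule K; simp add: carrier_sym_group_3)+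
  then have 1: "K (\<sigma> \<circ> \<tau> \<circ> \<sigma>) = K \<sigma>" "K \<tau> = K \<sigma>"
    by (simp_all add: S3_mult)
  have 2: "K (\<tau> \<circ> \<sigma>) = K (\<sigma> \<circ> \<tau>)" by (rule K; simp add: carrier_sym_group_3)
  have "sum K (carrier (sym_group 3)) =
      sum_list (map K [id, \<sigma>, \<tau>, \<sigma> \<circ> \<tau> \<circ> \<sigma>, \<sigma> \<circ> \<tau>, \<tau> \<circ> \<sigma>])"
    by (subst sum_list_distinct_conv_sum_set[OF S3_distinct]) (simp add: carrier_sym_group_3)
  then show "sum K (carrier (sym_group 3)) = K id + 3 * K \<sigma> + 2 * K (\<sigma> \<circ> \<tau>)"
    by (simp add: 1 2)
  show "sum K {id, \<sigma> \<circ> \<tau>, \<tau> \<circ> \<sigma>} = K id + 2 * K (\<sigma> \<circ> \<tau>)" "sum K {id, \<sigma>} = K id + K \<sigma>"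
    using S3_distinct 2 by auto
qed

section \<open>Transport to a group isomorphic to the symmetric group\<close>

lemma iso_sym_group_3_image:
  assumes "\<theta> \<in> iso (sym_group 3) G" "group G"
  shows "finite (carrier G)"
    and "A \<subseteq> carrier (sym_group 3) \<Longrightarrow> subgroup (\<theta> ` generate (sym_group 3) A) G"
    and "A \<subseteq> carrier (sym_group 3) \<Longrightarrow> finite (\<theta> ` generate (sym_group 3) A)"
proof -
  have bij: "bij_betw \<theta> (carrier (sym_group 3)) (carrier G)" and "\<theta> \<in> hom (sym_group 3) G"
    using assms(1) by (auto simp: iso_def)
  then have hom: "group_hom (sym_group 3) G \<theta>"
    using sym_group_is_group assms(2) by (simp add: group_hom_def group_hom_axioms_def)
  have fin: "finite (carrier (sym_group 3))" by (simp add: carrier_sym_group_3)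
  then show "finite (carrier G)" using bij_betw_finite[OF bij] by simp
  assume A: "A \<subseteq> carrier (sym_group 3)"
  show "subgroup (\<theta> ` generate (sym_group 3) A) G"
    by (intro group_hom.subgroup_img_is_subgroup[OF hom] group.generate_is_subgroup[OF sym_group_is_group A])
  show "finite (\<theta> ` generate (sym_group 3) A)"
    using finite_subset[OF group.generate_incl[OF sym_group_is_group A] fin] by simp
qed

lemma cycle_of_list_in_sym_group_3:
  "{cycle_of_list [1, 2]} \<subseteq> carrier (sym_group 3)" "{cycle_of_list [1, 2, 3]} \<subseteq> carrier (sym_group 3)"
  unfolding cycle_of_list_S3 by (simp_all add: carrier_sym_group_3)

text \<open>
  If \<open>\<pi>\<^sub>H\<close> is the permutation character of \<open>S\<^sub>3\<close> on the cosets of \<open>H\<close>, then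
  \<open>\<pi>\<^sub>1 + 2 \<pi>\<^sub>G = \<pi>\<^sub>C + 2 \<pi>\<^sub>D\<close> for \<open>G = S\<^sub>3\<close>, \<open>|C| = 3\<close>, \<open>|D| = 2\<close>. The lemma is the
  inner product of this identity with the class function \<open>M\<close>.
\<close>

lemma S3_class_function_relation:
  fixes M :: "'g \<Rightarrow> nat" and G :: "('g, 'm) monoid_scheme"
  assumes iso: "\<theta> \<in> iso (sym_group 3) G" and "group G"
    and M: "\<And>g h. g \<in> carrier G \<Longrightarrow> h \<in> carrier G \<Longrightarrow> M (g \<otimes>\<^bsub>G\<^esub> h) = M (h \<otimes>\<^bsub>G\<^esub> g)"
    and C3: "C3 = \<theta> ` generate (sym_group 3) {cycle_of_list [1, 2, 3]}"
    and C2: "C2 = \<theta> ` generate (sym_group 3) {cycle_of_list [1, 2]}"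
    and sums: "card (carrier G) * x = sum M (carrier G)" "card C3 * q = sum M C3" "card C2 * t = sum M C2"
  shows "M \<one>\<^bsub>G\<^esub> + 2 * x = q + 2 * t"
proof -
  have \<theta>: "\<theta> \<in> hom (sym_group 3) G" "bij_betw \<theta> (carrier (sym_group 3)) (carrier G)"
    using iso by (auto simp: iso_def)
  have hom: "group_hom (sym_group 3) G \<theta>"
    using \<theta>(1) sym_group_is_group assms(2) by (simp add: group_hom_def group_hom_axioms_def)
  \<comment> \<open>Pulled back along \<open>\<theta>\<close>, the sums of \<open>M\<close> over
    subgroups of \<open>G\<close> become sums over explicit sets of permutations.\<close>
  define K where "K \<pi> = M (\<theta> \<pi>)" for \<pi>
  have K: "K (\<pi> \<circ> \<rho>) = K (\<rho> \<circ> \<pi>)"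
    if "\<pi> \<in> carrier (sym_group 3)" "\<rho> \<in> carrier (sym_group 3)" for \<pi> \<rho>
    using M[of "\<theta> \<pi>" "\<theta> \<rho>"] that group_hom.hom_mult[OF hom] group_hom.hom_closed[OF hom]
    by (simp add: K_def sym_group_mult)
  have img: "card (\<theta> ` A) = card A" "sum M (\<theta> ` A) = sum K A" if "A \<subseteq> carrier (sym_group 3)" for A
    using inj_on_subset[OF bij_betw_imp_inj_on[OF \<theta>(2)] that] by (simp_all add: card_image sum.reindex K_def)
  have G: "carrier G = \<theta> ` carrier (sym_group 3)" using \<theta>(2) by (simp add: bij_betw_def)
  have subset: "{id, \<sigma> \<circ> \<tau>, \<tau> \<circ> \<sigma>} \<subseteq> carrier (sym_group 3)" "{id, \<sigma>} \<subseteq> carrier (sym_group 3)"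
    by (simp_all add: carrier_sym_group_3)
  note class_sums = S3_class_function_sums[of K, OF K]
  \<comment> \<open>With a, b, c the values of \<open>K\<close> at the identity, a transposition and
    a 3-cycle, both sides of the goal equal a + (a + 3b + 2c)/3.\<close>
  have "M \<one>\<^bsub>G\<^esub> = K id" using group_hom.hom_one[OF hom] by (simp add: K_def sym_group_one)
  moreover have "6 * x = K id + 3 * K \<sigma> + 2 * K (\<sigma> \<circ> \<tau>)"
    using sums(1) class_sums(1) unfolding G img[OF subset_refl] card_S3 by linarith
  moreover have "3 * q = K id + 2 * K (\<sigma> \<circ> \<tau>)"
    using sums(2) class_sums(2) unfolding C3 generate_3_cycle img[OF subset(1)] card_S3 by linarith
  moreover have "2 * t = K id + K \<sigma>"
    using sums(3) class_sums(3) unfolding C2 generate_transposition img[OF subset(2)] card_S3 by linarith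
  ultimately show ?thesis by linarith
qed

subsection \<open>Unique lifting of closed walks\<close>

text \<open>The appended letter \<open>f (hd C)\<close> encodes the closing condition:
  \<open>f = id\<close> gives ordinary closed words, a deck transformation \<open>f\<close> gives
  walks that close up only after applying it. Keeping the alphabet and the relation abstract lets
  arcs serve as letters.\<close>

definition twisted_cycles :: "'a set \<Rightarrow> ('a \<Rightarrow> 'a \<Rightarrow> bool) \<Rightarrow> ('a \<Rightarrow> 'a) \<Rightarrow> nat \<Rightarrow> 'a list set" where
  "twisted_cycles A R f m =
     {C. length C = m \<and> C \<noteq> [] \<and> set C \<subseteq> A \<and> successively R (C @ [f (hd C)])}"

lemma finite_twisted_cycles:
  assumes "finite A"
  shows "finite (twisted_cycles A R f m)"
  by (rule finite_subset[OF _ finite_lists_length_eq[OF assms, of m]]) (auto simp: twisted_cycles_def)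

text \<open>Double counting. A closed word \<open>D\<close> below and a letter \<open>a\<close> over
  \<open>hd D\<close> determine a unique lift of \<open>D\<close> starting at \<open>a\<close>. Its
  endpoint lies in the fibre of \<open>a\<close>, hence is \<open>\<psi> h a\<close> for exactly one
  \<open>h\<close>. So pairs (h, twisted word) biject with pairs (D, a), and each fibre has
  \<open>card H\<close> letters.\<close>

lemma card_twisted_cycles_quotient:
  fixes \<psi> :: "'h \<Rightarrow> 'a \<Rightarrow> 'a" and f :: "'a \<Rightarrow> 'b"
  assumes fin: "finite A" "finite H"
    and surj: "f ` A = B"
    and step: "\<And>a b. a \<in> A \<Longrightarrow> b \<in> A \<Longrightarrow> R a b \<Longrightarrow> S (f a) (f b)"
    and lift: "\<And>a c. a \<in> A \<Longrightarrow> c \<in> B \<Longrightarrow> S (f a) c \<Longrightarrow> \<exists>b\<in>A. R a b \<and> f b = c"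
    and inj: "\<And>a b b'. a \<in> A \<Longrightarrow> b \<in> A \<Longrightarrow> b' \<in> A \<Longrightarrow> R a b \<Longrightarrow> R a b' \<Longrightarrow> f b = f b' \<Longrightarrow> b = b'"
    and act: "\<And>h a. h \<in> H \<Longrightarrow> a \<in> A \<Longrightarrow> \<psi> h a \<in> A" "\<And>h a. h \<in> H \<Longrightarrow> a \<in> A \<Longrightarrow> f (\<psi> h a) = f a"
    and trans: "\<And>a b. a \<in> A \<Longrightarrow> b \<in> A \<Longrightarrow> f a = f b \<Longrightarrow> \<exists>h\<in>H. \<psi> h a = b"
    and free: "\<And>h h' a. h \<in> H \<Longrightarrow> h' \<in> H \<Longrightarrow> a \<in> A \<Longrightarrow> \<psi> h a = \<psi> h' a \<Longrightarrow> h = h'"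
  shows "card H * card (twisted_cycles B S id m) = (\<Sum>h\<in>H. card (twisted_cycles A R (\<psi> h) m))"
proof -
  have lift_exists: "\<exists>C. set C \<subseteq> A \<and> map f C = D \<and> successively R (a # C)"
    if "set D \<subseteq> B" "successively S (f a # D)" "a \<in> A" for D a
    using that
  proof (induction D arbitrary: a)
    case (Cons c D)
    then obtain b where b: "b \<in> A" "R a b" "f b = c" using lift[of a c] by auto
    with Cons.IH[of b] Cons.prems obtain C where "set C \<subseteq> A" "map f C = D" "successively R (b # C)"
      by auto
    with b show ?case by (intro exI[of _ "b # C"]) simp
  qed simp
  have lift_unique: "C = C'"
    if "set C \<subseteq> A" "set C' \<subseteq> A" "a \<in> A" "map f C = map f C'"
      "successively R (a # C)" "successively R (a # C')" for C C' a
    using that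
  proof (induction C arbitrary: a C')
    case (Cons b C)
    then obtain b' C'' where C': "C' = b' # C''" by (cases C') auto
    then have "b = b'" using inj[of a b b'] Cons.prems by simp
    moreover have "C = C''"
      by (rule Cons.IH[of _ b]) (use Cons.prems C' \<open>b = b'\<close> in simp_all)
    ultimately show ?case using C' by simp
  qed simp
  have f_succ: "successively S (map f C)" if "set C \<subseteq> A" "successively R C" for C
    unfolding successively_map using that(2) by (rule successively_mono) (use that(1) step in blast)
  let ?fib = "\<lambda>D. {a \<in> A. f a = hd D}"
  let ?\<Phi> = "\<lambda>(h, C). (map f C, hd C)"
  let ?L = "SIGMA h:H. twisted_cycles A R (\<psi> h) m" and ?R = "SIGMA D:twisted_cycles B S id m. ?fib D"
  have inj_\<Phi>: "h = h' \<and> C = C'"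
    if h: "h \<in> H" "h' \<in> H" and C: "C \<in> twisted_cycles A R (\<psi> h) m" "C' \<in> twisted_cycles A R (\<psi> h') m"
      and eq: "map f C = map f C'" "hd C = hd C'" for h C h' C'
  proof -
    from C(1) obtain a E where E: "C = a # E" "a \<in> A" "set E \<subseteq> A" "successively R (a # (E @ [\<psi> h a]))"
      by (cases C) (simp_all add: twisted_cycles_def)
    from C(2) eq E(1) obtain E' where E': "C' = a # E'" "set E' \<subseteq> A" "successively R (a # (E' @ [\<psi> h' a]))"
      by (cases C') (simp_all add: twisted_cycles_def)
    \<comment> \<open>The endpoint is kept in the lifted word, so that uniqueness of lifts also
      identifies the two twists; freeness then gives \<open>h = h'\<close>.\<close>
    have "E @ [\<psi> h a] = E' @ [\<psi> h' a]"
      by (rule lift_unique[of _ _ a]) (use E E' eq act h in simp_all)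
    then show ?thesis using free[OF h E(2)] E(1) E'(1) by simp
  qed
  have \<Phi>_in: "map f C \<in> twisted_cycles B S id m \<and> hd C \<in> ?fib (map f C)"
    if h: "h \<in> H" and C: "C \<in> twisted_cycles A R (\<psi> h) m" for h C
  proof -
    from C have C': "C \<noteq> []" "set C \<subseteq> A" "length C = m" "successively R (C @ [\<psi> h (hd C)])"
      by (simp_all add: twisted_cycles_def)
    then have hd: "hd C \<in> A" by auto
    have "successively S (map f (C @ [\<psi> h (hd C)]))"
      by (rule f_succ) (use h C' hd act in simp_all)
    moreover have "set (map f C) \<subseteq> B" using C'(2) surj by auto
    ultimately show ?thesis
      using h C' hd act(2) by (simp add: twisted_cycles_def hd_map)
  qed
  have surj_\<Phi>: "\<exists>h\<in>H. \<exists>C\<in>twisted_cycles A R (\<psi> h) m. map f C = D \<and> hd C = a"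
    if D: "D \<in> twisted_cycles B S id m" and a: "a \<in> A" "f a = hd D" for D a
  proof -
    define D' where "D' = tl D"
    have D': "D = f a # D'" using D a(2) by (cases D) (simp_all add: twisted_cycles_def D'_def)
    have "set (D' @ [f a]) \<subseteq> B" "successively S (f a # (D' @ [f a]))" "length D = m"
      using D by (simp_all add: D' twisted_cycles_def)
    \<comment> \<open>The closing letter \<open>f a\<close> is lifted along with the word; the last
      letter of the lift reveals the twist.\<close>
    then obtain E where E: "set E \<subseteq> A" "map f E = D' @ [f a]" "successively R (a # E)"
      using lift_exists[of "D' @ [f a]" a] a(1) by blast
    then obtain E' b where E': "E = E' @ [b]" by (cases E rule: rev_cases) auto
    have map: "map f E' = D'" and b: "f b = f a" "b \<in> A" using E E' by simp_all
    then obtain h where h: "h \<in> H" "\<psi> h a = b" using trans[OF a(1) b(2)] by auto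
    have "a # E' \<in> twisted_cycles A R (\<psi> h) m"
      using E E' h a(1) \<open>length D = m\<close> by (simp add: twisted_cycles_def D' flip: map)
    moreover have "map f (a # E') = D" by (simp add: D' map)
    ultimately show ?thesis using h(1) by (intro bexI[of _ h] bexI[of _ "a # E'"]) simp_all
  qed
  have "bij_betw ?\<Phi> ?L ?R"
    unfolding bij_betw_def
  proof
    show "inj_on ?\<Phi> ?L"
    proof (rule inj_onI, clarify)
      fix h C h' C'
      assume "h \<in> H" "C \<in> twisted_cycles A R (\<psi> h) m" "h' \<in> H" "C' \<in> twisted_cycles A R (\<psi> h') m"
        "map f C = map f C'" "hd C = hd C'"
      then show "h = h' \<and> C = C'" by (intro inj_\<Phi>)
    qed
    show "?\<Phi> ` ?L = ?R"
    proof
      show "?\<Phi> ` ?L \<subseteq> ?R"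
      proof clarify
        fix h C assume "h \<in> H" "C \<in> twisted_cycles A R (\<psi> h) m"
        then show "map f C \<in> twisted_cycles B S id m \<and> hd C \<in> ?fib (map f C)" by (rule \<Phi>_in)
      qed
      show "?R \<subseteq> ?\<Phi> ` ?L"
      proof clarify
        fix D a assume "D \<in> twisted_cycles B S id m" "a \<in> A" "f a = hd D"
        from surj_\<Phi>[OF this] obtain h C where hC: "h \<in> H" "C \<in> twisted_cycles A R (\<psi> h) m"
          and eq: "map f C = D" "hd C = a" by blast
        show "(D, a) \<in> ?\<Phi> ` ?L"
          by (rule image_eqI[of _ _ "(h, C)"]) (use hC eq in simp_all)
      qed
    qed
  qed
  then have "card ?L = card ?R" by (rule bij_betw_same_card)
  \<comment> \<open>A fibre is a single free orbit of \<open>H\<close>.\<close>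
  moreover have "card (?fib D) = card H" if "D \<in> twisted_cycles B S id m" for D
  proof -
    have "hd D \<in> f ` A" using that surj by (cases D) (simp_all add: twisted_cycles_def)
    then obtain b where b: "b \<in> A" "f b = hd D" by force
    have "a \<in> (\<lambda>h. \<psi> h b) ` H" if "a \<in> ?fib D" for a
      using trans[OF b(1), of a] that b(2) by auto
    then have "?fib D = (\<lambda>h. \<psi> h b) ` H" using act b by auto
    moreover have "inj_on (\<lambda>h. \<psi> h b) H" using free b(1) by (auto simp: inj_on_def)
    ultimately show ?thesis by (simp add: card_image)
  qed
  moreover have "finite B" using fin(1) surj by blast
  ultimately show ?thesis
    using fin by (simp add: finite_twisted_cycles)
qed

subsection \<open>Primitive words\<close>

text \<open>The empty word is not primitive, being its own square.\<close>

definition primitive :: "'a list \<Rightarrow> bool" where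
  "primitive C \<longleftrightarrow> \<not> (\<exists>D k. k > 1 \<and> C = concat (replicate k D))"

lemma concat_replicate_snoc:
  "concat (replicate n xs) @ xs = xs @ concat (replicate n xs)"
  by (induction n) auto

lemma rotate1_concat_replicate:
  "rotate1 (concat (replicate n xs)) = concat (replicate n (rotate1 xs))"
proof (cases xs)
  case (Cons x ys)
  have "concat (replicate k (x # ys)) @ [x] = x # concat (replicate k (ys @ [x]))" for k
    by (induction k) auto
  then show ?thesis using Cons by (cases n) auto
next
  case Nil
  then show ?thesis by (induction n) auto
qed

lemma rotate_concat_replicate:
  "rotate k (concat (replicate n xs)) = concat (replicate n (rotate k xs))"
  by (induction k) (auto simp: rotate1_concat_replicate)

text \<open>Rotation commutes with powers, so a root of the rotated word rotates back to a root of
  \<open>C\<close>.\<close>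

lemma primitive_rotate:
  assumes "primitive C"
  shows "primitive (rotate k C)"
  unfolding primitive_def
proof clarify
  fix D n assume n: "n > (1::nat)" "rotate k C = concat (replicate n D)"
  \<comment> \<open>\<open>rotate j\<close> is the inverse of \<open>rotate k\<close> on words of
    this length.\<close>
  define j where "j = length C - k mod length C"
  have "C = rotate j (rotate k C)"
  proof (cases "C = []")
    case False
    have "(j + k) mod length C = 0"
      by (metis False add.commute j_def le_add_diff_inverse length_greater_0_conv mod_add_left_eq mod_less_divisor mod_self nat_less_le)
    then show ?thesis by (simp add: rotate_rotate rotate_id)
  qed auto
  also have "\<dots> = concat (replicate n (rotate j D))"
    by (simp add: n rotate_concat_replicate)
  finally show False using assms n by (auto simp: primitive_def)
qed

text \<open>A rotation fixing \<open>C\<close> splits it into two commuting pieces, and commuting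
  words are powers of a common word. If both pieces were non-empty, \<open>C\<close> would be a
  proper power.\<close>

lemma primitive_rotate_eq:
  assumes "primitive C" "k < length C" "rotate k C = C"
  shows "k = 0"
proof (rule ccontr)
  assume "k \<noteq> 0"
  have "drop k C @ take k C = take k C @ drop k C"
    using assms by (simp add: rotate_drop_take)
  moreover have "take k C \<noteq> []" "drop k C \<noteq> []" using assms(2) \<open>k \<noteq> 0\<close> by auto
  ultimately obtain n zs where "n > 1" "concat (replicate n zs) = take k C @ drop k C"
    using comm_append_is_replicate[of "take k C" "drop k C"] by metis
  then show False using assms(1) unfolding primitive_def by (metis append_take_drop_id)
qed

lemma inj_on_rotate_primitive:
  assumes "primitive C"
  shows "inj_on (\<lambda>k. rotate k C) {..<length C}"
proof -
  have "j = k" if "j \<le> k" "k < length C" "rotate j C = rotate k C" for j k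
  proof -
    \<comment> \<open>Applying the inverse of \<open>rotate j\<close> to both sides leaves a
      rotation by \<open>k - j\<close> that fixes \<open>C\<close>.\<close>
    have "rotate (length C - j) (rotate j C) = C"
      using that(1,2) by (simp only: rotate_rotate) (simp add: rotate_id)
    moreover have "rotate (length C - j) (rotate k C) = rotate (k - j) C"
    proof -
      have "length C - j + k = length C + (k - j)" using that by auto
      then show ?thesis by (simp add: rotate_rotate) (metis mod_add_self1 rotate_conv_mod)
    qed
    ultimately have "rotate (k - j) C = C" using that(3) by simp
    then have "k - j = 0" by (intro primitive_rotate_eq[OF assms]) (use that(2) in linarith)
    then show ?thesis using that(1) by simp
  qed
  then show ?thesis unfolding inj_on_def by (metis lessThan_iff linear)
qed

text \<open>The source of the factor d in the formula for \<open>N\<^sub>m\<close>: a prime of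
  length d consists of d cycles.\<close>

lemma card_rotations_primitive:
  assumes "primitive C" "C \<noteq> []"
  shows "card (range (\<lambda>k. rotate k C)) = length C"
proof -
  have "range (\<lambda>k. rotate k C) = (\<lambda>k. rotate k C) ` {..<length C}"
    using assms(2) by (auto simp: image_def) (metis length_greater_0_conv lessThan_iff mod_less_divisor rotate_conv_mod)
  then show ?thesis by (simp add: card_image inj_on_rotate_primitive assms)
qed

text \<open>Both roots commute with their common power, which forces them to commute with each
  other. They are then powers of one word, and primitivity makes both exponents 1.\<close>

lemma primitive_root_unique:
  assumes "primitive D" "primitive D'" and eq: "concat (replicate k D) = concat (replicate k' D')"
    and ne: "concat (replicate k D) \<noteq> []"
  shows "D = D'"
proof -
  let ?C = "concat (replicate k D)"
  have pos: "k > 0" "k' > 0" using ne eq by (auto intro: ccontr)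
  have pre: "?C = D @ concat (replicate (k - 1) D)" "?C = D' @ concat (replicate (k' - 1) D')"
    using pos eq by (cases k; cases k'; simp)+
  have comm: "?C @ D = D @ ?C" "?C @ D' = D' @ ?C"
    by (rule concat_replicate_snoc) (unfold eq, rule concat_replicate_snoc)
  \<comment> \<open>With C the common power, CC = CEe = ECe = EFfe, so EF is the prefix of CC of
    length |E| + |F|. Exchanging the roles of E and F gives EF = FE.\<close>
  have swap: "E @ F = take (length E + length F) (?C @ ?C)"
    if C: "?C = E @ e" "?C = F @ f" and E: "?C @ E = E @ ?C" for E F e f
  proof -
    have "?C @ ?C = (?C @ E) @ e" using C(1) by (metis append.assoc)
    also have "\<dots> = E @ F @ f @ e" unfolding E using C(2) by (metis append.assoc)
    finally show ?thesis by simp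
  qed
  have "D @ D' = D' @ D"
    using swap[OF pre comm(1)] swap[OF pre(2,1) comm(2)] by (simp only: add.commute)
  then obtain m n zs where z: "concat (replicate m zs) = D" "concat (replicate n zs) = D'"
    using comm_append_are_replicate[of D D'] by metis
  have "D \<noteq> []" "D' \<noteq> []" using ne eq by (auto simp: concat_eq_Nil_conv)
  then have "m \<noteq> 0" "n \<noteq> 0" using z by (auto intro: ccontr)
  moreover have "\<not> m > 1" "\<not> n > 1" using assms z unfolding primitive_def by metis+
  ultimately have "m = 1" "n = 1" by auto
  then show ?thesis using z by simp
qed

lemma primitive_root_exists:
  assumes "C \<noteq> []"
  shows "\<exists>D k. primitive D \<and> k > 0 \<and> C = concat (replicate k D)"
  using assms
proof (induction "length C" arbitrary: C rule: less_induct)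
  case less
  show ?case
  proof (cases "primitive C")
    case True
    then show ?thesis by (intro exI[of _ C] exI[of _ 1]) auto
  next
    case False
    then obtain D k where D: "k > 1" "C = concat (replicate k D)" by (auto simp: primitive_def)
    then have "D \<noteq> []" using less.prems by auto
    have "length C = k * length D" using D by (simp add: length_concat sum_list_replicate)
    then have "length D < length C" using D \<open>D \<noteq> []\<close> by simp
    then obtain E j where E: "primitive E" "j > 0" "D = concat (replicate j E)"
      using less.hyps \<open>D \<noteq> []\<close> by blast
    have "concat (replicate k (concat (replicate j E))) = concat (replicate (k * j) E)" for k
      by (induction k) (auto simp: replicate_add)
    then show ?thesis using D E by (intro exI[of _ E] exI[of _ "k * j"]) auto
  qed
qed

text \<open>At each junction of two copies the last letter of \<open>D\<close> meets
  \<open>hd D\<close>, which is exactly the closing condition of \<open>D\<close> itself.\<close>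

lemma successively_concat_replicate:
  assumes "D \<noteq> []" "k > 0"
  shows "successively R (concat (replicate k D) @ [hd D]) \<longleftrightarrow> successively R (D @ [hd D])"
  using assms(2)
proof (induction k rule: nat_induct_non_zero)
  case (Suc k)
  have "hd (concat (replicate k D) @ [hd D]) = hd D" using Suc.hyps assms(1) by (cases k) auto
  then show ?case using Suc assms(1) by (auto simp: successively_append_iff)
qed auto

definition prime_words :: "'a set \<Rightarrow> ('a \<Rightarrow> 'a \<Rightarrow> bool) \<Rightarrow> nat \<Rightarrow> 'a list set" where
  "prime_words A R m = {C \<in> twisted_cycles A R id m. primitive C}"

lemma concat_replicate_twisted_cycles:
  assumes "k > 0"
  shows "concat (replicate k D) \<in> twisted_cycles A R id (k * d) \<longleftrightarrow> D \<in> twisted_cycles A R id d"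
proof (cases "D = []")
  case False
  have "hd (concat (replicate k D)) = hd D" using assms False by (cases k) auto
  then show ?thesis
    using assms False successively_concat_replicate[of D k R]
    by (auto simp: twisted_cycles_def length_concat sum_list_replicate)
qed (auto simp: twisted_cycles_def)

text \<open>Each closed word of length m is D^(m/d) for a unique primitive \<open>D\<close>, whose
  length d divides m.\<close>

lemma card_cycles_eq_sum_prime_words:
  assumes "finite A" "m > 0"
  shows "card (twisted_cycles A R id m) = (\<Sum>d | d dvd m. card (prime_words A R d))"
proof -
  let ?P = "\<lambda>d D. concat (replicate (m div d) D)"
  have div: "m div d > 0" "m div d * d = m" if "d dvd m" for d
    using that assms(2) by (auto simp: dvd_div_eq_0_iff)
  have Un: "twisted_cycles A R id m = (\<Union>d\<in>{d. d dvd m}. ?P d ` prime_words A R d)"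
  proof (intro equalityI subsetI)
    fix C assume C: "C \<in> twisted_cycles A R id m"
    then obtain D k where D: "primitive D" "k > 0" "C = concat (replicate k D)"
      using primitive_root_exists[of C] by (auto simp: twisted_cycles_def)
    then have m: "m = k * length D"
      using C by (auto simp: twisted_cycles_def length_concat sum_list_replicate)
    then have "D \<in> prime_words A R (length D)" "m div length D = k"
      using C D concat_replicate_twisted_cycles[of k D A R "length D"] assms(2)
      by (auto simp: prime_words_def)
    then show "C \<in> (\<Union>d\<in>{d. d dvd m}. ?P d ` prime_words A R d)"
      using D m by (intro UN_I[of "length D"]) auto
  next
    fix C assume "C \<in> (\<Union>d\<in>{d. d dvd m}. ?P d ` prime_words A R d)"
    then obtain d D where d: "d dvd m" "D \<in> prime_words A R d" "C = ?P d D" by auto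
    then show "C \<in> twisted_cycles A R id m"
      using concat_replicate_twisted_cycles[of "m div d" D A R d] div[of d]
      by (simp add: prime_words_def)
  qed
  \<comment> \<open>The lengths \<open>d\<close> and \<open>d'\<close> may differ: this gives both
    disjointness of the images and injectivity on each of them.\<close>
  have eq: "D = D'"
    if "d dvd m" "D \<in> prime_words A R d" "D' \<in> prime_words A R d'" "?P d D = ?P d' D'" for d d' D D'
  proof (rule primitive_root_unique)
    show "?P d D \<noteq> []"
      using that(2) div[OF that(1)] by (auto simp: prime_words_def twisted_cycles_def)
  qed (use that in \<open>auto simp: prime_words_def\<close>)
  have "card (\<Union>d\<in>{d. d dvd m}. ?P d ` prime_words A R d) =
      (\<Sum>d | d dvd m. card (?P d ` prime_words A R d))"
  proof (rule card_UN_disjoint)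
    show "finite {d. d dvd m}" using assms(2) by simp
    show "\<forall>d\<in>{d. d dvd m}. finite (?P d ` prime_words A R d)"
      using finite_twisted_cycles[OF assms(1)] by (auto simp: prime_words_def)
    show "\<forall>d\<in>{d. d dvd m}. \<forall>d'\<in>{d. d dvd m}. d \<noteq> d' \<longrightarrow>
        ?P d ` prime_words A R d \<inter> ?P d' ` prime_words A R d' = {}"
    proof (intro ballI impI equals0I)
      fix d d' C assume d: "d \<in> {d. d dvd m}" "d' \<in> {d. d dvd m}" "d \<noteq> d'"
        and "C \<in> ?P d ` prime_words A R d \<inter> ?P d' ` prime_words A R d'"
      then obtain D D' where D: "D \<in> prime_words A R d" "D' \<in> prime_words A R d'" "?P d D = ?P d' D'"
        by auto
      then have "D = D'" using eq d(1) by blast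
      then show False using D d(3) by (auto simp: prime_words_def twisted_cycles_def)
    qed
  qed
  also have "\<dots> = (\<Sum>d | d dvd m. card (prime_words A R d))"
    by (intro sum.cong refl card_image inj_onI) (use eq in blast)
  finally show ?thesis by (simp add: Un)
qed

lemma rotate_twisted_cycles:
  assumes "C \<in> twisted_cycles A R id m"
  shows "rotate k C \<in> twisted_cycles A R id m"
proof (induction k)
  case (Suc k)
  obtain x xs where "rotate k C = x # xs" using Suc by (cases "rotate k C") (auto simp: twisted_cycles_def)
  with Suc show ?case
    by (cases xs) (auto simp: twisted_cycles_def successively_append_iff successively_Cons hd_append)
qed (use assms in \<open>simp add: id_def\<close>)

lemma rotate_prime_words:
  "C \<in> prime_words A R m \<Longrightarrow> rotate k C \<in> prime_words A R m"
  by (simp add: prime_words_def rotate_twisted_cycles primitive_rotate)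

subsection \<open>Primes and the zeta function\<close>

text \<open>Composability and absence of backtracking are merged into one relation on arcs, so that
  non-backtracking cycles become closed words.\<close>

definition nb_step :: "'a \<times> 'a \<Rightarrow> 'a \<times> 'a \<Rightarrow> bool" where
  "nb_step a b \<longleftrightarrow> snd a = fst b \<and> a \<noteq> prod.swap b"

abbreviation nb_cycles :: "'a pair_pre_digraph \<Rightarrow> nat \<Rightarrow> ('a \<times> 'a) list set" where
  "nb_cycles \<Gamma> \<equiv> twisted_cycles (parcs \<Gamma>) nb_step id"

lemma successively_cyclic_iff:
  assumes "C \<noteq> []"
  shows "successively R (C @ [hd C]) \<longleftrightarrow> (\<forall>i < length C. R (C ! i) (C ! (Suc i mod length C)))"
proof -
  have "(C @ [hd C]) ! Suc i = C ! (Suc i mod length C)" if "i < length C" for i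
    using that assms by (cases "Suc i = length C") (auto simp: nth_append hd_conv_nth)
  then show ?thesis by (auto simp: successively_conv_nth nth_append)
qed

lemma closed_walk_iff:
  "closed_walk \<Gamma> C \<longleftrightarrow> C \<in> twisted_cycles (parcs \<Gamma>) (\<lambda>a b. snd a = fst b) id (length C)"
  by (auto simp: closed_walk_def twisted_cycles_def successively_cyclic_iff)

lemma closed_walk_non_backtracking_iff:
  "closed_walk \<Gamma> C \<and> non_backtracking C \<longleftrightarrow> C \<in> nb_cycles \<Gamma> (length C)"
  by (auto simp: closed_walk_def non_backtracking_def nb_step_def twisted_cycles_def successively_cyclic_iff)

lemma prime_cycles_iff:
  "C \<in> prime_cycles \<Gamma> \<longleftrightarrow> C \<in> prime_words (parcs \<Gamma>) nb_step (length C)"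
proof -
  \<comment> \<open>\<open>prime_cycles\<close> asks for roots that are closed walks,
    \<open>primitive\<close> for arbitrary roots. The notions agree because a root of a closed walk
    is itself closed.\<close>
  have "closed_walk \<Gamma> D" if "closed_walk \<Gamma> (concat (replicate k D))" "k > 1" for D k
    using that concat_replicate_twisted_cycles[of k D "parcs \<Gamma>" "\<lambda>a b. snd a = fst b" "length D"]
    by (simp add: closed_walk_iff length_concat sum_list_replicate)
  then show ?thesis
    unfolding prime_cycles_def prime_words_def primitive_def mem_Collect_eq
      closed_walk_non_backtracking_iff[symmetric]
    by blast
qed

definition num_primes :: "'a pair_pre_digraph \<Rightarrow> nat \<Rightarrow> nat" where
  "num_primes \<Gamma> d = card {P \<in> graph_primes \<Gamma>. prime_length P = d}"

text \<open>The primes of length d partition the primitive cycles of length d into rotation classes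
  of size d.\<close>

lemma card_prime_words_eq:
  assumes "finite (parcs \<Gamma>)"
  shows "card (prime_words (parcs \<Gamma>) nb_step d) = d * num_primes \<Gamma> d"
proof -
  let ?S = "{P \<in> graph_primes \<Gamma>. prime_length P = d}"
  have Un: "\<Union>?S = prime_words (parcs \<Gamma>) nb_step d"
  proof (intro equalityI subsetI)
    fix C assume "C \<in> \<Union>?S"
    then obtain P where P: "P \<in> graph_primes \<Gamma>" "prime_length P = d" "C \<in> P" by auto
    then have "length C = d" "C \<in> prime_cycles \<Gamma>"
      using prime_length_eq[OF P(1,3)] graph_primes_memD(2)[OF P(1)] by auto
    then show "C \<in> prime_words (parcs \<Gamma>) nb_step d" by (simp add: prime_cycles_iff)
  next
    fix C assume C: "C \<in> prime_words (parcs \<Gamma>) nb_step d"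
    then have len: "length C = d" by (simp add: prime_words_def twisted_cycles_def)
    with C have pc: "C \<in> prime_cycles \<Gamma>" by (simp add: prime_cycles_iff)
    let ?P = "cyclic_equiv \<Gamma> `` {C}"
    have "?P \<in> graph_primes \<Gamma>" unfolding graph_primes_def using pc by (rule quotientI)
    moreover have "C \<in> ?P" using equiv_class_self[OF equiv_cyclic_equiv pc] .
    ultimately show "C \<in> \<Union>?S" using prime_length_eq len by blast
  qed
  have fin: "finite (prime_words (parcs \<Gamma>) nb_step d)"
    using finite_twisted_cycles[OF assms] by (simp add: prime_words_def)
  have "d * card ?S = card (\<Union>?S)"
  proof (rule card_partition)
    show "finite ?S" by (rule finite_subset[OF _ finite_graph_primes_le[OF assms, of d]]) auto
    show "finite (\<Union>?S)" using Un fin by simp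
  next
    fix P assume "P \<in> ?S"
    then have P: "P \<in> graph_primes \<Gamma>" "prime_length P = d" by auto
    then obtain C where C: "C \<in> prime_cycles \<Gamma>" "P = cyclic_equiv \<Gamma> `` {C}"
      by (auto simp: graph_primes_def quotient_def)
    have "rotate k C \<in> prime_cycles \<Gamma>" for k
      using C(1) by (simp add: prime_cycles_iff rotate_prime_words)
    then have "P = range (\<lambda>k. rotate k C)"
      using C by (auto simp: cyclic_equiv_def)
    moreover have "primitive C" "C \<noteq> []"
      using C(1) by (simp_all add: prime_cycles_iff prime_words_def twisted_cycles_def)
    moreover have "length C = d"
      using prime_length_eq[OF P(1), of C] P(2) C equiv_class_self[OF equiv_cyclic_equiv C(1)] by simp
    ultimately show "card P = d" by (simp add: card_rotations_primitive)
  next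
    fix P P' assume "P \<in> ?S" "P' \<in> ?S" "P \<noteq> P'"
    then show "P \<inter> P' = {}"
      using quotient_disj[OF equiv_cyclic_equiv] by (auto simp: graph_primes_def)
  qed
  then show ?thesis by (simp add: Un num_primes_def)
qed

section \<open>From cycle counts to zeta functions\<close>

lemma card_nb_cycles_eq_sum:
  assumes "finite (parcs \<Gamma>)" "m > 0"
  shows "card (nb_cycles \<Gamma> m) = (\<Sum>d | d dvd m. d * num_primes \<Gamma> d)"
  using card_cycles_eq_sum_prime_words[OF assms(1), of m nb_step] assms(2)
  by (simp add: card_prime_words_eq[OF assms(1)])

text \<open>The sets of primes of length at most n are cofinal among the finite sets of primes, so
  the limit along the net is also the limit of this sequence; grouping primes by length gives the
  exponents.\<close>

lemma ihara_zeta_LIMSEQ: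
  assumes "finite (parcs \<Gamma>)"
  shows "(\<lambda>n. \<Prod>d=1..n. inverse (1 - fps_X ^ d) ^ num_primes \<Gamma> d) \<longlonglongrightarrow> ihara_zeta \<Gamma>"
proof -
  let ?S = "\<lambda>n. {P \<in> graph_primes \<Gamma>. prime_length P \<le> n}"
  let ?z = "\<lambda>P. inverse (1 - fps_X ^ prime_length P) :: complex fps"
  have fin: "finite (?S n)" for n by (rule finite_graph_primes_le[OF assms])
  have "filterlim ?S (finite_subsets_at_top (graph_primes \<Gamma>)) sequentially"
    unfolding filterlim_finite_subsets_at_top
  proof (intro allI impI)
    \<comment> \<open>\<open>X\<close> is absorbed once n reaches its largest prime length; the
      inserted 0 covers empty \<open>X\<close>.\<close>
    fix X assume X: "finite X \<and> X \<subseteq> graph_primes \<Gamma>"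
    show "\<forall>\<^sub>F n in sequentially. finite (?S n) \<and> X \<subseteq> ?S n \<and> ?S n \<subseteq> graph_primes \<Gamma>"
      using eventually_ge_at_top[of "Max (insert 0 (prime_length ` X))"]
    proof eventually_elim
      case (elim n)
      then have "prime_length P \<le> n" if "P \<in> X" for P
        using X that by (meson Max_ge finite_imageI finite_insert imageI insertI2 order_trans)
      then show ?case using X fin by auto
    qed
  qed
  then have "(\<lambda>n. \<Prod>P\<in>?S n. ?z P) \<longlonglongrightarrow> ihara_zeta \<Gamma>"
    by (rule filterlim_compose[OF ihara_zeta_tendsto[OF assms]])
  moreover have "(\<Prod>P\<in>?S n. ?z P) = (\<Prod>d=1..n. inverse (1 - fps_X ^ d) ^ num_primes \<Gamma> d)" for n
  proof -
    have "(\<Prod>P\<in>?S n. ?z P) = (\<Prod>d=1..n. \<Prod>P | P \<in> ?S n \<and> prime_length P = d. ?z P)"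
    proof (rule prod.group[symmetric])
      show "prime_length ` ?S n \<subseteq> {1..n}" using prime_length_pos by (auto simp: Suc_le_eq)
    qed (use fin in auto)
    also have "\<dots> = (\<Prod>d=1..n. inverse (1 - fps_X ^ d) ^ num_primes \<Gamma> d)"
    proof (rule prod.cong[OF refl])
      fix d assume "d \<in> {1..n}"
      then have "{P \<in> ?S n. prime_length P = d} = {P \<in> graph_primes \<Gamma>. prime_length P = d}" by auto
      then show "(\<Prod>P | P \<in> ?S n \<and> prime_length P = d. ?z P) = inverse (1 - fps_X ^ d) ^ num_primes \<Gamma> d"
        by (simp add: num_primes_def)
    qed
    finally show ?thesis .
  qed
  ultimately show ?thesis by simp
qed

text \<open>Convergence means that each coefficient is eventually constant, and coefficient n of a
  product involves only the coefficients up to n.\<close>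

lemma tendsto_fps_mult:
  fixes a b :: "'a :: ring fps"
  assumes "(f \<longlongrightarrow> a) F" "(g \<longlongrightarrow> b) F"
  shows "((\<lambda>x. f x * g x) \<longlongrightarrow> a * b) F"
proof (rule tendsto_fpsI)
  fix n
  have "\<forall>\<^sub>F x in F. \<forall>k\<in>{..n}. fps_nth (f x) k = fps_nth a k"
    "\<forall>\<^sub>F x in F. \<forall>k\<in>{..n}. fps_nth (g x) k = fps_nth b k"
    using assms by (simp_all add: eventually_ball_finite_distrib tendsto_fps_iff)
  then show "\<forall>\<^sub>F x in F. fps_nth (f x * g x) n = fps_nth (a * b) n"
    by eventually_elim (auto simp: fps_mult_nth intro!: sum.cong)
qed

text \<open>In the divisor sums for m all terms at proper divisors agree by induction, so the terms
  at m agree and the factor m cancels.\<close>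

lemma num_primes_relation:
  assumes fin: "finite (parcs Y)" "finite (parcs X)" "finite (parcs Q)" "finite (parcs T)"
    and cycles: "\<And>m. m > 0 \<Longrightarrow>
      card (nb_cycles Y m) + 2 * card (nb_cycles X m) = card (nb_cycles Q m) + 2 * card (nb_cycles T m)"
    and "d > 0"
  shows "num_primes Y d + 2 * num_primes X d = num_primes Q d + 2 * num_primes T d"
  using \<open>d > 0\<close>
proof (induction d rule: less_induct)
  case (less m)
  let ?L = "\<lambda>d. num_primes Y d + 2 * num_primes X d" and ?R = "\<lambda>d. num_primes Q d + 2 * num_primes T d"
  have "(\<Sum>d | d dvd m. d * ?L d) = (\<Sum>d | d dvd m. d * ?R d)"
    using cycles[OF less.prems]
    by (simp add: card_nb_cycles_eq_sum fin less.prems sum_distrib_left sum.distrib algebra_simps)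
  moreover have "(\<Sum>d | d dvd m. f d) = f m + (\<Sum>d\<in>{d. d dvd m} - {m}. f d)" for f :: "nat \<Rightarrow> nat"
    using less.prems by (intro sum.remove) auto
  moreover have "(\<Sum>d\<in>{d. d dvd m} - {m}. d * ?L d) = (\<Sum>d\<in>{d. d dvd m} - {m}. d * ?R d)"
  proof (rule sum.cong[OF refl])
    fix d assume d: "d \<in> {d. d dvd m} - {m}"
    then have "d < m" "d > 0" using less.prems by (auto simp: dvd_imp_le le_neq_implies_less intro: dvd_pos_nat)
    then show "d * ?L d = d * ?R d" using less.IH by simp
  qed
  ultimately have "m * ?L m = m * ?R m" by simp
  then show ?case using less.prems by simp
qed

text \<open>Both sides are limits of the same sequence: in the partial products the exponents of
  each factor at d agree by the relation between prime counts.\<close>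

lemma ihara_zeta_relation:
  assumes fin: "finite (parcs Y)" "finite (parcs X)" "finite (parcs Q)" "finite (parcs T)"
    and cycles: "\<And>m. m > 0 \<Longrightarrow>
      card (nb_cycles Y m) + 2 * card (nb_cycles X m) = card (nb_cycles Q m) + 2 * card (nb_cycles T m)"
  shows "ihara_zeta Y * ihara_zeta X ^ 2 = ihara_zeta Q * ihara_zeta T ^ 2"
proof (rule LIMSEQ_unique)
  let ?p = "\<lambda>\<Gamma> n. \<Prod>d=1..n. inverse (1 - fps_X ^ d) ^ num_primes \<Gamma> d :: complex fps"
  show "(\<lambda>n. ?p Y n * ?p X n ^ 2) \<longlonglongrightarrow> ihara_zeta Y * ihara_zeta X ^ 2"
    unfolding power2_eq_square by (intro tendsto_fps_mult ihara_zeta_LIMSEQ fin)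
  have "(\<lambda>n. ?p Q n * ?p T n ^ 2) \<longlonglongrightarrow> ihara_zeta Q * ihara_zeta T ^ 2"
    unfolding power2_eq_square by (intro tendsto_fps_mult ihara_zeta_LIMSEQ fin)
  moreover have "?p Y n * ?p X n ^ 2 = ?p Q n * ?p T n ^ 2" for n
    unfolding prod_power_distrib prod.distrib[symmetric]
  proof (rule prod.cong[OF refl])
    fix d assume "d \<in> {1..n}"
    then have "num_primes Y d + 2 * num_primes X d = num_primes Q d + 2 * num_primes T d"
      using num_primes_relation[OF fin cycles] by simp
    then show "inverse (1 - fps_X ^ d) ^ num_primes Y d * (inverse (1 - fps_X ^ d) ^ num_primes X d)\<^sup>2 =
        inverse (1 - fps_X ^ d) ^ num_primes Q d * (inverse (1 - fps_X ^ d :: complex fps) ^ num_primes T d)\<^sup>2"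
      by (simp flip: power_mult power_add add: mult.commute)
  qed
  ultimately show "(\<lambda>n. ?p Y n * ?p X n ^ 2) \<longlonglongrightarrow> ihara_zeta Q * ihara_zeta T ^ 2" by simp
qed

subsection \<open>Quotients by free actions\<close>

lemma pair_graphD:
  assumes "pair_graph \<Gamma>"
  shows "finite (parcs \<Gamma>)"
    and "\<And>a. a \<in> parcs \<Gamma> \<Longrightarrow> fst a \<in> pverts \<Gamma> \<and> snd a \<in> pverts \<Gamma>"
    and "\<And>u v. (u, v) \<in> parcs \<Gamma> \<Longrightarrow> u \<in> pverts \<Gamma> \<and> v \<in> pverts \<Gamma>"
    and "\<And>u v. (u, v) \<in> parcs \<Gamma> \<Longrightarrow> (v, u) \<in> parcs \<Gamma>"
proof -
  from assms have fin: "pair_fin_digraph \<Gamma>" and sym: "pair_sym_digraph \<Gamma>"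
    by (simp_all add: pair_graph_def pair_pseudo_graph_def)
  from fin have wf: "pair_wf_digraph \<Gamma>" and "finite (parcs \<Gamma>)"
    by (simp_all add: pair_fin_digraph_def pair_fin_digraph_axioms_def)
  then show "finite (parcs \<Gamma>)" by simp
  from wf show verts: "\<And>a. a \<in> parcs \<Gamma> \<Longrightarrow> fst a \<in> pverts \<Gamma> \<and> snd a \<in> pverts \<Gamma>"
    unfolding pair_wf_digraph_def by blast
  show "\<And>u v. (u, v) \<in> parcs \<Gamma> \<Longrightarrow> u \<in> pverts \<Gamma> \<and> v \<in> pverts \<Gamma>"
    using verts by force
  from sym have "sym (parcs \<Gamma>)"
    by (simp add: pair_sym_digraph_def pair_sym_digraph_axioms_def symmetric_def)
  then show "\<And>u v. (u, v) \<in> parcs \<Gamma> \<Longrightarrow> (v, u) \<in> parcs \<Gamma>" by (rule symD)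
qed

text \<open>The number \<open>M\<^sub>m(g)\<close> of the introduction.\<close>

definition num_twisted :: "'b pair_pre_digraph \<Rightarrow> ('g \<Rightarrow> 'b \<Rightarrow> 'b) \<Rightarrow> nat \<Rightarrow> 'g \<Rightarrow> nat" where
  "num_twisted Y \<phi> m g = card (twisted_cycles (parcs Y) nb_step (map_prod (\<phi> g) (\<phi> g)) m)"

text \<open>Isolates the conditions on \<open>Y\<close> and the action alone, so that the base
  \<open>X\<close> and the quotients by subgroups can be treated alike.\<close>

definition free_graph_action ::
  "('g, 'm) monoid_scheme \<Rightarrow> 'b pair_pre_digraph \<Rightarrow> ('g \<Rightarrow> 'b \<Rightarrow> 'b) \<Rightarrow> bool"
where
  "free_graph_action G Y \<phi> \<longleftrightarrow>
     group_action G (pverts Y) \<phi> \<and> pair_graph Y \<and>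
     (\<forall>g \<in> carrier G. \<forall>u \<in> pverts Y. \<forall>v \<in> pverts Y.
        (\<phi> g u, \<phi> g v) \<in> parcs Y \<longleftrightarrow> (u, v) \<in> parcs Y) \<and>
     (\<forall>v \<in> pverts Y. stabilizer G \<phi> v = {\<one>\<^bsub>G\<^esub>})"

section \<open>Walks under a free action by graph automorphisms\<close>

context
  fixes G :: "('g, 'm) monoid_scheme" (structure) and Y :: "'b pair_pre_digraph" and \<phi>
  assumes free_action: "free_graph_action G Y \<phi>"
begin

lemma free_graph_action_group_action: "group_action G (pverts Y) \<phi>"
  and free_graph_action_pair_graph: "pair_graph Y"
  and act_arcs_iff: "\<And>g u v. g \<in> carrier G \<Longrightarrow> u \<in> pverts Y \<Longrightarrow> v \<in> pverts Y \<Longrightarrow>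
    (\<phi> g u, \<phi> g v) \<in> parcs Y \<longleftrightarrow> (u, v) \<in> parcs Y"
  and free_graph_action_stabilizer: "\<And>v. v \<in> pverts Y \<Longrightarrow> stabilizer G \<phi> v = {\<one>}"
  using free_action by (simp_all add: free_graph_action_def)

lemma free_graph_action_group: "group G"
  using free_graph_action_group_action by (simp add: group_action_def group_hom_def)

lemmas free_graph_action_finite_parcs = pair_graphD(1)[OF free_graph_action_pair_graph]
lemmas free_graph_action_parcs_pverts = pair_graphD(2)[OF free_graph_action_pair_graph]
lemmas free_graph_action_parcs_pverts_pair = pair_graphD(3)[OF free_graph_action_pair_graph]
lemmas act_mult = group_action.composition_rule[OF free_graph_action_group_action]

lemma act_one: "v \<in> pverts Y \<Longrightarrow> \<phi> \<one> v = v"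
  using group_action.id_eq_one[OF free_graph_action_group_action] by (metis restrict_apply')

lemma act_closed: "g \<in> carrier G \<Longrightarrow> v \<in> pverts Y \<Longrightarrow> \<phi> g v \<in> pverts Y"
  by (rule group_action.element_image[OF free_graph_action_group_action _ _ refl])

lemma act_inj:
  "g \<in> carrier G \<Longrightarrow> u \<in> pverts Y \<Longrightarrow> v \<in> pverts Y \<Longrightarrow> \<phi> g u = \<phi> g v \<Longrightarrow> u = v"
  using group_action.inj_prop[OF free_graph_action_group_action] by (simp add: inj_on_def)

lemma act_inv:
  assumes "g \<in> carrier G" "v \<in> pverts Y"
  shows "\<phi> (inv g) (\<phi> g v) = v"
  using act_mult[OF assms(2) group.inv_closed[OF free_graph_action_group assms(1)] assms(1)] assms
  by (simp add: group.l_inv[OF free_graph_action_group] act_one)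

lemma act_eqD:
  assumes "g \<in> carrier G" "h \<in> carrier G" "v \<in> pverts Y" "\<phi> g v = \<phi> h v"
  shows "g = h"
proof -
  have inv: "inv h \<in> carrier G" using free_graph_action_group assms(2) by (rule group.inv_closed)
  have "\<phi> (inv h \<otimes> g) v = v"
    using assms inv by (simp add: act_mult act_inv)
  moreover have "inv h \<otimes> g \<in> carrier G"
    using inv assms(1) free_graph_action_group by (simp add: group.is_monoid monoid.m_closed)
  ultimately have "inv h \<otimes> g \<in> stabilizer G \<phi> v" by (simp add: stabilizer_def)
  then have "inv h \<otimes> g = \<one>" using free_graph_action_stabilizer assms(3) by auto
  then have "inv g = inv h" using assms(1) inv by (rule group.inv_equality[OF free_graph_action_group])
  then show ?thesis using assms(1,2) by (metis group.inv_inv[OF free_graph_action_group])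
qed

lemma act_arc_closed:
  assumes "g \<in> carrier G" "a \<in> parcs Y"
  shows "map_prod (\<phi> g) (\<phi> g) a \<in> parcs Y"
  using assms act_arcs_iff[OF assms(1), of "fst a" "snd a"] free_graph_action_parcs_pverts[OF assms(2)]
  by (simp add: map_prod_def case_prod_beta)

lemma inj_on_act_arcs:
  assumes "g \<in> carrier G"
  shows "inj_on (map_prod (\<phi> g) (\<phi> g)) (parcs Y)"
proof (rule inj_onI)
  fix a b assume "a \<in> parcs Y" "b \<in> parcs Y" "map_prod (\<phi> g) (\<phi> g) a = map_prod (\<phi> g) (\<phi> g) b"
  then show "a = b"
    using act_inj[OF assms, of "fst a" "fst b"] act_inj[OF assms, of "snd a" "snd b"] free_graph_action_parcs_pverts
    by (simp add: map_prod_def case_prod_beta prod_eq_iff)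
qed

lemma nb_step_act:
  assumes "g \<in> carrier G" "a \<in> parcs Y" "b \<in> parcs Y" "nb_step a b"
  shows "nb_step (map_prod (\<phi> g) (\<phi> g) a) (map_prod (\<phi> g) (\<phi> g) b)"
  using act_inj[OF assms(1), of "fst a" "snd b"] free_graph_action_parcs_pverts[OF assms(2)] free_graph_action_parcs_pverts[OF assms(3)] assms(4)
  by (auto simp: nb_step_def map_prod_def case_prod_beta prod_eq_iff)

lemma act_arc_mult:
  assumes "g \<in> carrier G" "h \<in> carrier G" "a \<in> parcs Y"
  shows "map_prod (\<phi> (g \<otimes> h)) (\<phi> (g \<otimes> h)) a = map_prod (\<phi> g) (\<phi> g) (map_prod (\<phi> h) (\<phi> h) a)"
  using assms(1,2) free_graph_action_parcs_pverts[OF assms(3)] by (simp add: map_prod_def case_prod_beta act_mult)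

text \<open>Since h(gh)x = (hg)hx, translation by \<open>h\<close> carries walks closing up under gh
  injectively to walks closing up under hg. Exchanging g and h gives the reverse inequality. This
  makes \<open>M\<^sub>m\<close> a class function.\<close>

lemma num_twisted_commute:
  assumes g: "g \<in> carrier G" and h: "h \<in> carrier G"
  shows "num_twisted Y \<phi> m (g \<otimes> h) = num_twisted Y \<phi> m (h \<otimes> g)"
proof (rule antisym)
  have le: "num_twisted Y \<phi> m (g \<otimes> h) \<le> num_twisted Y \<phi> m (h \<otimes> g)"
    if g: "g \<in> carrier G" and h: "h \<in> carrier G" for g h
  proof -
    let ?a = "\<lambda>g. map_prod (\<phi> g) (\<phi> g)"
    let ?M = "\<lambda>g. twisted_cycles (parcs Y) nb_step (?a g) m"
    have "map (?a h) C \<in> ?M (h \<otimes> g)" if "C \<in> ?M (g \<otimes> h)" for C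
    proof -
      from that have C: "length C = m" "C \<noteq> []" "set C \<subseteq> parcs Y" "successively nb_step C"
        and step: "nb_step (last C) (?a (g \<otimes> h) (hd C))"
        by (auto simp: twisted_cycles_def successively_append_iff)
      then have hd: "hd C \<in> parcs Y" and last: "last C \<in> parcs Y" by auto
      have "successively (\<lambda>x y. nb_step (?a h x) (?a h y)) C"
        using C(4) by (rule successively_mono) (use C(3) h nb_step_act in blast)
      moreover have "nb_step (?a h (last C)) (?a (h \<otimes> g) (?a h (hd C)))"
        using nb_step_act[OF h last _ step] hd act_arc_closed g h by (simp add: act_arc_mult)
      moreover have "set (map (?a h) C) \<subseteq> parcs Y" using act_arc_closed[OF h] C(3) by auto
      ultimately show ?thesis
        using C(1,2) by (simp add: twisted_cycles_def successively_append_iff successively_map hd_map last_map)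
    qed
    then have "map (?a h) ` ?M (g \<otimes> h) \<subseteq> ?M (h \<otimes> g)" by blast
    moreover have "?M (g \<otimes> h) \<subseteq> lists (parcs Y)" by (auto simp: twisted_cycles_def)
    then have "inj_on (map (?a h)) (?M (g \<otimes> h))"
      by (rule inj_on_subset[OF inj_on_map_lists[OF inj_on_act_arcs[OF h]]])
    ultimately show ?thesis
      unfolding num_twisted_def using finite_twisted_cycles[OF free_graph_action_finite_parcs] by (intro card_inj_on_le)
  qed
  show "num_twisted Y \<phi> m (g \<otimes> h) \<le> num_twisted Y \<phi> m (h \<otimes> g)" using g h by (rule le)
  show "num_twisted Y \<phi> m (h \<otimes> g) \<le> num_twisted Y \<phi> m (g \<otimes> h)" using h g by (rule le)
qed

text \<open>The lifting count with arcs as letters. The vertex map \<open>q\<close> is abstract so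
  that it can be an orbit map, the covering map or the identity; it must be injective on the
  neighbours of each vertex and have the \<open>H\<close>-orbits as fibres.\<close>

lemma card_nb_cycles_quotient:
  assumes H: "H \<subseteq> carrier G" "finite H"
    and arcs: "parcs Z = map_prod q q ` parcs Y"
    and inj: "\<And>u v w. (u, v) \<in> parcs Y \<Longrightarrow> (u, w) \<in> parcs Y \<Longrightarrow> q v = q w \<Longrightarrow> v = w"
    and fibre: "\<And>u v. u \<in> pverts Y \<Longrightarrow> v \<in> pverts Y \<Longrightarrow> q u = q v \<longleftrightarrow> (\<exists>h\<in>H. \<phi> h u = v)"
  shows "card H * card (nb_cycles Z m) = (\<Sum>h\<in>H. num_twisted Y \<phi> m h)"
proof -
  have q_act: "q (\<phi> h v) = q v" if "h \<in> H" "v \<in> pverts Y" for h v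
    using fibre[OF that(2) act_closed[OF subsetD[OF H(1) that(1)] that(2)]] that(1) by auto
  show ?thesis
    unfolding num_twisted_def
  proof (rule card_twisted_cycles_quotient)
    show "finite (parcs Y)" by (rule free_graph_action_finite_parcs)
    show "map_prod q q ` parcs Y = parcs Z" by (simp add: arcs)
    show "finite H" by fact
  next
    fix a b assume ab: "a \<in> parcs Y" "b \<in> parcs Y" "nb_step a b"
    then obtain u v w where uvw: "a = (u, v)" "b = (v, w)" "u \<noteq> w" by (cases a; cases b) (auto simp: nb_step_def)
    \<comment> \<open>Reversing the first arc makes \<open>u\<close> and \<open>w\<close> two
      neighbours of \<open>v\<close>, so local injectivity keeps their images apart and no
      backtracking arises below.\<close>
    then have "(v, u) \<in> parcs Y" using ab pair_graphD(4)[OF free_graph_action_pair_graph] by blast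
    then have "q u \<noteq> q w" using inj uvw ab by blast
    then show "nb_step (map_prod q q a) (map_prod q q b)" by (simp add: uvw nb_step_def)
  next
    fix a c assume a: "a \<in> parcs Y" and c: "c \<in> parcs Z" and ac: "nb_step (map_prod q q a) c"
    obtain u v where uv: "a = (u, v)" by (cases a)
    obtain v' w' where vw': "(v', w') \<in> parcs Y" "c = (q v', q w')" using c arcs by auto
    have "q v' = q v" "q w' \<noteq> q u" using ac by (auto simp: uv vw' nb_step_def)
    \<comment> \<open>Some arc lies over \<open>c\<close>; translating it by \<open>h\<close> makes
      it start at the end of \<open>a\<close>.\<close>
    then obtain h where h: "h \<in> H" "\<phi> h v' = v" using fibre a vw' uv free_graph_action_parcs_pverts_pair by metis
    define w where "w = \<phi> h w'"
    have w: "(v, w) \<in> parcs Y" using act_arc_closed[of h "(v', w')"] h H vw' by (auto simp: w_def)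
    have qw: "q w = q w'" using fibre[of w' w] h w vw' free_graph_action_parcs_pverts_pair w_def by metis
    have "nb_step a (v, w) \<and> map_prod q q (v, w) = c"
      using qw \<open>q v' = q v\<close> \<open>q w' \<noteq> q u\<close> by (auto simp: nb_step_def uv vw')
    with w show "\<exists>b\<in>parcs Y. nb_step a b \<and> map_prod q q b = c" by blast
  next
    fix a b b' assume arcs: "a \<in> parcs Y" "b \<in> parcs Y" "b' \<in> parcs Y"
      and step: "nb_step a b" "nb_step a b'" and eq: "map_prod q q b = map_prod q q b'"
    from step obtain v w w' where b: "b = (v, w)" "b' = (v, w')"
      by (cases b; cases b') (simp add: nb_step_def)
    moreover have "w = w'" by (rule inj[of v]) (use arcs eq b in simp_all)
    ultimately show "b = b'" by simp
  next
    fix h a assume h: "h \<in> H" and a: "a \<in> parcs Y"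
    show "map_prod (\<phi> h) (\<phi> h) a \<in> parcs Y" by (rule act_arc_closed[OF subsetD[OF H(1) h] a])
    show "map_prod q q (map_prod (\<phi> h) (\<phi> h) a) = map_prod q q a"
      using q_act[OF h] free_graph_action_parcs_pverts[OF a] by (simp add: map_prod_def case_prod_beta)
  next
    fix a b assume ab: "a \<in> parcs Y" "b \<in> parcs Y" "map_prod q q a = map_prod q q b"
    obtain u v u' v' where uv: "a = (u, v)" "b = (u', v')" by (cases a; cases b)
    then have q: "q u = q u'" "q v = q v'" using ab(3) by simp_all
    have verts: "u \<in> pverts Y" "v \<in> pverts Y" "u' \<in> pverts Y"
      using free_graph_action_parcs_pverts[OF ab(1)] free_graph_action_parcs_pverts[OF ab(2)] uv by simp_all
    then obtain h where h: "h \<in> H" "\<phi> h u = u'" using fibre q(1) by blast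
    \<comment> \<open>The element matching the tails also matches the heads:
      \<open>\<phi> h v\<close> and \<open>v'\<close> are neighbours of \<open>u'\<close> with the
      same image.\<close>
    have "(u', \<phi> h v) \<in> parcs Y" using act_arc_closed[OF subsetD[OF H(1) h(1)] ab(1)] h uv by simp
    then have "\<phi> h v = v'" using inj[of u' "\<phi> h v" v'] ab(2) uv q q_act[OF h(1) verts(2)] by simp
    then show "\<exists>h\<in>H. map_prod (\<phi> h) (\<phi> h) a = b"
      using h uv by (intro bexI[of _ h]) simp_all
  next
    fix h h' a assume "h \<in> H" "h' \<in> H" "a \<in> parcs Y" "map_prod (\<phi> h) (\<phi> h) a = map_prod (\<phi> h') (\<phi> h') a"
    then show "h = h'"
      using act_eqD[of h h' "fst a"] H(1) free_graph_action_parcs_pverts[of a] by (simp add: map_prod_def case_prod_beta subset_iff)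
  qed
qed

section \<open>Quotient graphs by subgroups\<close>

lemma free_graph_action_orbit_eq_iff:
  assumes "subgroup H G" "u \<in> pverts Y" "v \<in> pverts Y"
  shows "orbit (G\<lparr>carrier := H\<rparr>) \<phi> u = orbit (G\<lparr>carrier := H\<rparr>) \<phi> v \<longleftrightarrow> (\<exists>h\<in>H. \<phi> h u = v)"
proof -
  note H = subgroup.mem_carrier[OF assms(1)] subgroup.one_closed[OF assms(1)]
    subgroup.m_closed[OF assms(1)] subgroup.m_inv_closed[OF assms(1)]
  have orb: "orbit (G\<lparr>carrier := H\<rparr>) \<phi> x = (\<lambda>h. \<phi> h x) ` H" for x
    by (auto simp: orbit_def)
  have sub: "(\<lambda>h. \<phi> h (\<phi> g x)) ` H \<subseteq> (\<lambda>h. \<phi> h x) ` H" if "g \<in> H" "x \<in> pverts Y" for g x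
    using that H by (auto simp flip: act_mult)
  show ?thesis
  proof
    assume "orbit (G\<lparr>carrier := H\<rparr>) \<phi> u = orbit (G\<lparr>carrier := H\<rparr>) \<phi> v"
    moreover have "v \<in> (\<lambda>h. \<phi> h v) ` H" by (rule image_eqI[where x = "\<one>"]) (simp_all add: act_one assms(3) H(2))
    ultimately have "v \<in> (\<lambda>h. \<phi> h u) ` H" by (simp only: orb)
    then show "\<exists>h\<in>H. \<phi> h u = v" by blast
  next
    assume "\<exists>h\<in>H. \<phi> h u = v"
    then obtain h where h: "h \<in> H" "v = \<phi> h u" by auto
    have "\<phi> (inv h) v = u" unfolding h(2) using H(1)[OF h(1)] assms(2) by (rule act_inv)
    then have "(\<lambda>h. \<phi> h u) ` H \<subseteq> (\<lambda>h. \<phi> h v) ` H"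
      using sub[of "inv h" v] H(4)[OF h(1)] assms(3) by simp
    moreover have "(\<lambda>h. \<phi> h v) ` H \<subseteq> (\<lambda>h. \<phi> h u) ` H"
      using sub[OF h(1) assms(2)] by (simp only: h(2))
    ultimately show "orbit (G\<lparr>carrier := H\<rparr>) \<phi> u = orbit (G\<lparr>carrier := H\<rparr>) \<phi> v"
      by (simp add: orb)
  qed
qed

text \<open>Adjacent representatives \<open>a\<close>, \<open>b\<close> have the same orbits as the
  chosen ones, so an arc between orbits is the image of the arc (a, b) of \<open>Y\<close>.\<close>

lemma parcs_quotient_graph:
  assumes "subgroup H G"
  shows "parcs (quotient_graph G \<phi> Y H) =
    map_prod (orbit (G\<lparr>carrier := H\<rparr>) \<phi>) (orbit (G\<lparr>carrier := H\<rparr>) \<phi>) ` parcs Y" (is "_ = map_prod ?q ?q ` _")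
proof -
  note H = subgroup.mem_carrier[OF assms] subgroup.one_closed[OF assms]
  have orb: "a \<in> pverts Y \<and> ?q a = ?q x" if x: "x \<in> pverts Y" and a: "a \<in> ?q x" for a x
  proof -
    obtain h where h: "h \<in> H" "a = \<phi> h x" using a by (auto simp: orbit_def)
    then have "a \<in> pverts Y" using act_closed x H(1) by simp
    then show ?thesis using free_graph_action_orbit_eq_iff[OF assms x, of a] h by auto
  qed
  have self: "x \<in> ?q x" if "x \<in> pverts Y" for x
    using act_one[OF that] H(2) by (auto simp: orbit_def intro!: exI[of _ "\<one>"])
  show ?thesis
  proof (intro equalityI subsetI)
    fix e assume "e \<in> parcs (quotient_graph G \<phi> Y H)"
    then obtain x y a b where "e = (?q x, ?q y)" "x \<in> pverts Y" "y \<in> pverts Y"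
      "a \<in> ?q x" "b \<in> ?q y" "(a, b) \<in> parcs Y"
      by (auto simp: quotient_graph_def Let_def orbits_def)
    moreover from this have "e = (?q a, ?q b)" using orb by metis
    ultimately show "e \<in> map_prod ?q ?q ` parcs Y"
      by (intro image_eqI[of _ _ "(a, b)"]) simp_all
  next
    fix e assume "e \<in> map_prod ?q ?q ` parcs Y"
    then obtain u v where uv: "e = (?q u, ?q v)" "(u, v) \<in> parcs Y" by auto
    then have "u \<in> pverts Y" "v \<in> pverts Y" using free_graph_action_parcs_pverts_pair by auto
    then show "e \<in> parcs (quotient_graph G \<phi> Y H)"
      using uv self[of u] self[of v] by (auto simp: quotient_graph_def Let_def orbits_def)
  qed
qed

text \<open>The last hypothesis forbids distinct neighbours of a vertex in one
  \<open>G\<close>-orbit, which makes the orbit map of every subgroup locally injective.\<close>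

lemma card_nb_cycles_quotient_graph:
  assumes H: "subgroup H G" "finite H"
    and inj: "\<And>g u v. g \<in> carrier G \<Longrightarrow> (u, v) \<in> parcs Y \<Longrightarrow> (u, \<phi> g v) \<in> parcs Y \<Longrightarrow> \<phi> g v = v"
  shows "card H * card (nb_cycles (quotient_graph G \<phi> Y H) m) = (\<Sum>h\<in>H. num_twisted Y \<phi> m h)"
proof (rule card_nb_cycles_quotient[OF _ H(2) parcs_quotient_graph[OF H(1)]])
  show "H \<subseteq> carrier G" using H(1) by (rule subgroup.subset)
  show "orbit (G\<lparr>carrier := H\<rparr>) \<phi> u = orbit (G\<lparr>carrier := H\<rparr>) \<phi> v \<longleftrightarrow> (\<exists>h\<in>H. \<phi> h u = v)"
    if "u \<in> pverts Y" "v \<in> pverts Y" for u v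
    using H(1) that by (rule free_graph_action_orbit_eq_iff)
next
  fix u v w
  assume arcs: "(u, v) \<in> parcs Y" "(u, w) \<in> parcs Y"
    and "orbit (G\<lparr>carrier := H\<rparr>) \<phi> v = orbit (G\<lparr>carrier := H\<rparr>) \<phi> w"
  then obtain h where h: "h \<in> H" "\<phi> h v = w"
    using free_graph_action_orbit_eq_iff[OF H(1), of v w] free_graph_action_parcs_pverts_pair by auto
  have "\<phi> h v = v" by (rule inj) (use h arcs subgroup.subset[OF H(1)] in auto)
  then show "v = w" using h by simp
qed

text \<open>The trivial subgroup, with \<open>q\<close> the identity.\<close>

lemma card_nb_cycles_eq_num_twisted: "card (nb_cycles Y m) = num_twisted Y \<phi> m \<one>"
proof -
  have "card {\<one>} * card (nb_cycles Y m) = (\<Sum>h\<in>{\<one>}. num_twisted Y \<phi> m h)"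
    by (rule card_nb_cycles_quotient[where q = id])
      (auto simp: act_one group.is_monoid[OF free_graph_action_group] monoid.one_closed map_prod_def)
  then show ?thesis by simp
qed

end

section \<open>Covering maps and Galois covers\<close>

lemma covering_map_inj:
  assumes "pair_graph Y" "covering_map p Y X"
    and "(u, v) \<in> parcs Y" "(u, w) \<in> parcs Y" "p v = p w"
  shows "v = w"
proof -
  have "u \<in> pverts Y" using pair_graphD(3)[OF assms(1)] assms(3) by blast
  then have "inj_on (map_prod p p) (out_arcs (with_proj Y) u)"
    using assms(2) by (simp add: covering_map_def bij_betw_def)
  then have "(u, v) = (u, w)" by (rule inj_onD) (use assms(3-) in auto)
  then show ?thesis by simp
qed

text \<open>Some vertex lies over the tail of a given arc, and local surjectivity lifts the arc from
  there.\<close>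

lemma covering_map_parcs:
  assumes "pair_graph X" "covering_map p Y X"
  shows "parcs X = map_prod p p ` parcs Y"
proof (intro equalityI subsetI)
  fix e assume e: "e \<in> parcs X"
  have "fst e \<in> p ` pverts Y"
    using pair_graphD(2)[OF assms(1) e] assms(2) by (simp add: covering_map_def)
  then obtain v where v: "v \<in> pverts Y" "fst e = p v" by auto
  then have "map_prod p p ` out_arcs (with_proj Y) v = out_arcs (with_proj X) (p v)"
    using assms(2) by (simp add: covering_map_def bij_betw_def)
  then have "e \<in> map_prod p p ` out_arcs (with_proj Y) v" using e v by auto
  then show "e \<in> map_prod p p ` parcs Y" by auto
next
  fix e assume "e \<in> map_prod p p ` parcs Y"
  then show "e \<in> parcs X" using assms(2) by (auto simp: covering_map_def)
qed

lemma galois_coverD: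
  assumes "galois_cover G \<phi> p Y X"
  shows "covering_map p Y X"
    and "\<And>g v. g \<in> carrier G \<Longrightarrow> v \<in> pverts Y \<Longrightarrow> p (\<phi> g v) = p v"
    and "\<And>u v. u \<in> pverts Y \<Longrightarrow> v \<in> pverts Y \<Longrightarrow> p u = p v \<Longrightarrow> \<exists>g\<in>carrier G. \<phi> g u = v"
  using assms by (auto simp: galois_cover_def)

lemma galois_cover_free_graph_action:
  "pair_graph Y \<Longrightarrow> galois_cover G \<phi> p Y X \<Longrightarrow> free_graph_action G Y \<phi>"
  by (simp add: galois_cover_def free_graph_action_def)

text \<open>Here \<open>q\<close> is the covering map itself, whose fibres are the
  \<open>G\<close>-orbits.\<close>

lemma galois_cover_card_nb_cycles:
  assumes "pair_graph X" "pair_graph Y" and cover: "galois_cover G \<phi> p Y X" and "finite (carrier G)"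
  shows "card (carrier G) * card (nb_cycles X m) = (\<Sum>g\<in>carrier G. num_twisted Y \<phi> m g)"
proof (rule card_nb_cycles_quotient)
  show "free_graph_action G Y \<phi>" using assms(2) cover by (rule galois_cover_free_graph_action)
  show "parcs X = map_prod p p ` parcs Y"
    using assms(1) galois_coverD(1)[OF cover] by (rule covering_map_parcs)
  show "p u = p v \<longleftrightarrow> (\<exists>g\<in>carrier G. \<phi> g u = v)" if "u \<in> pverts Y" "v \<in> pverts Y" for u v
    using galois_coverD(3)[OF cover that] galois_coverD(2)[OF cover _ that(1)] by auto
  show "v = w" if "(u, v) \<in> parcs Y" "(u, w) \<in> parcs Y" "p v = p w" for u v w
    using assms(2) galois_coverD(1)[OF cover] that by (rule covering_map_inj)
qed (use assms(4) in auto)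

text \<open>Local injectivity is inherited from \<open>p\<close>: neighbours of a vertex in the same
  orbit have the same image in \<open>X\<close>, hence coincide.\<close>

lemma galois_cover_card_nb_cycles_quotient_graph:
  assumes "pair_graph Y" and cover: "galois_cover G \<phi> p Y X" and "subgroup H G" "finite H"
  shows "card H * card (nb_cycles (quotient_graph G \<phi> Y H) m) = (\<Sum>h\<in>H. num_twisted Y \<phi> m h)"
proof (rule card_nb_cycles_quotient_graph)
  show "free_graph_action G Y \<phi>" using assms(1) cover by (rule galois_cover_free_graph_action)
  fix g u v assume g: "g \<in> carrier G" and uv: "(u, v) \<in> parcs Y" "(u, \<phi> g v) \<in> parcs Y"
  then have "p (\<phi> g v) = p v" using galois_coverD(2)[OF cover] pair_graphD(3)[OF assms(1)] by blast
  then show "\<phi> g v = v" by (rule covering_map_inj[OF assms(1) galois_coverD(1)[OF cover] uv(2,1)])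
qed fact+

lemma finite_parcs_quotient_graph:
  assumes "free_graph_action G Y \<phi>" "subgroup H G"
  shows "finite (parcs (quotient_graph G \<phi> Y H))"
  unfolding parcs_quotient_graph[OF assms] by (rule finite_imageI[OF free_graph_action_finite_parcs[OF assms(1)]])

text \<open>The character relation applied to \<open>M\<^sub>m\<close>: the counts for the whole
  group and the two cyclic subgroups supply its three sums, and \<open>M\<^sub>m\<close> at the
  identity is the count for \<open>Y\<close>.\<close>

lemma galois_cover_S3_nb_cycles_relation:
  fixes X :: "'a pair_pre_digraph" and Y :: "'b pair_pre_digraph" and G :: "('g, 'm) monoid_scheme"
  assumes "pair_graph X" "pair_graph Y" "galois_cover G \<phi> p Y X" and iso: "\<theta> \<in> iso (sym_group 3) G"
  shows "card (nb_cycles Y m) + 2 * card (nb_cycles X m) =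
    card (nb_cycles (quotient_graph G \<phi> Y (\<theta> ` generate (sym_group 3) {cycle_of_list [1, 2, 3]})) m) +
    2 * card (nb_cycles (quotient_graph G \<phi> Y (\<theta> ` generate (sym_group 3) {cycle_of_list [1, 2]})) m)"
proof -
  have act: "free_graph_action G Y \<phi>" using assms(2,3) by (rule galois_cover_free_graph_action)
  note group = free_graph_action_group[OF act]
  note img = iso_sym_group_3_image[OF iso group]
  show ?thesis
    unfolding card_nb_cycles_eq_num_twisted[OF act]
    by (rule S3_class_function_relation[OF iso group num_twisted_commute[OF act] refl refl
          galois_cover_card_nb_cycles[OF assms(1-3) img(1)]
          galois_cover_card_nb_cycles_quotient_graph[OF assms(2,3) img(2,3)]
          galois_cover_card_nb_cycles_quotient_graph[OF assms(2,3) img(2,3)]])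
      (assumption | rule cycle_of_list_in_sym_group_3)+
qed

theorem theorem7:
  fixes X :: "'a pair_pre_digraph" and Y :: "'b pair_pre_digraph" and p :: "'b \<Rightarrow> 'a"
    and G :: "('g, 'm) monoid_scheme" and \<phi> :: "'g \<Rightarrow> 'b \<Rightarrow> 'b"
    and \<theta> :: "(nat \<Rightarrow> nat) \<Rightarrow> 'g"
    and Q T :: "'b set pair_pre_digraph"
  assumes "pair_graph X" and "pair_graph Y"
    and "galois_cover G \<phi> p Y X"
    and "\<theta> \<in> iso (sym_group 3) G"
    and "Q = quotient_graph G \<phi> Y (\<theta> ` generate (sym_group 3) {cycle_of_list [1, 2, 3]})"
    and "T = quotient_graph G \<phi> Y (\<theta> ` generate (sym_group 3) {cycle_of_list [1, 2]})"
  shows "ihara_zeta Y * ihara_zeta X ^ 2 = ihara_zeta Q * ihara_zeta T ^ 2"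
proof -
  have act: "free_graph_action G Y \<phi>" using assms(2,3) by (rule galois_cover_free_graph_action)
  show ?thesis
  proof (rule ihara_zeta_relation)
    show "finite (parcs Y)" "finite (parcs X)" using assms(1,2) by (simp_all add: pair_graphD(1))
    show "finite (parcs Q)" "finite (parcs T)"
      unfolding assms(5,6) using iso_sym_group_3_image(2)[OF assms(4) free_graph_action_group[OF act]]
      by (simp_all only: finite_parcs_quotient_graph[OF act] cycle_of_list_in_sym_group_3)
    show "card (nb_cycles Y m) + 2 * card (nb_cycles X m) = card (nb_cycles Q m) + 2 * card (nb_cycles T m)" for m
      unfolding assms(5,6) using assms(1-4) by (rule galois_cover_S3_nb_cycles_relation)
  qed
qed

end
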